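(* Let $k$ be an algebraically closed field of characteristic zero, $n$ a positive integer, and let $N_n$ be the Lie algebra of all $n\times n$ strictly upper triangular matrices over $k$, considered as the nilradical of the standard Borel subalgebra $B_n$ of $\mathfrak{sl}(n,k)$. Then: (i) $N_n$ admits an ideal $P$ which is a CP of $N_n$, and $\alpha(N_n)=[n^2/4]$ (which equals $q^2$ if $n=2q$ and $q(q+1)$ if $n=2q+1$). (ii) $\alpha(N_n)=\alpha(B_n)=\alpha(\mathfrak{sl}(n,k))=[n^2/4]$. In particular, $P$ is also an abelian subalgebra of $B_n$, and of $\mathfrak{sl}(n,k)$, of maximum dimension.
   Context: $[r]$ denotes the greatest integer $\le r$. $B_n$ is the Lie algebra of upper triangular $n\times n$ matrices of trace zero. For a finite dimensional Lie algebra $L$ and $\xi\in L^*$ put $L(\xi)=\{x\in L : \xi([x,y])=0 \text{ for all } y\in L\}$; the index is $i(L)=\min_{\xi\in L^*}\dim L(\xi)$; the magic number is $c(L)=(\dim L+i(L))/2$ (an integer). $\alpha(L)$ denotes the maximum dimension of an abelian subalgebra of $L$. A CP (commutative polarization) of $L$ is a commutative subalgebra $P$ of $L$ with $\dim P=c(L)$. *)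

theory Defs
  imports "HOL-Analysis.Determinants" "HOL-Computational_Algebra.Polynomial"
begin

(* The carrier L is a subspace of an ambient vector space, so that several Lie algebras
   sharing one bracket (here N_n, B_n and sl(n)) and their common subspaces can be compared
   as sets.  No finite-dimensionality is required of the ambient space. *)
locale fin_dim_lie_algebra = vector_space scale
  for scale :: "'k::field \<Rightarrow> 'v::ab_group_add \<Rightarrow> 'v" +
  fixes bracket :: "'v \<Rightarrow> 'v \<Rightarrow> 'v"
    and L :: "'v set"
  assumes subspace_carrier: "subspace L"
    and finite_dimensional: "\<exists>S. finite S \<and> L \<subseteq> span S"
    and bracket_closed: "\<lbrakk>x \<in> L; y \<in> L\<rbrakk> \<Longrightarrow> bracket x y \<in> L"
    and bracket_add_left: "\<lbrakk>x \<in> L; y \<in> L; z \<in> L\<rbrakk> \<Longrightarrow>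
      bracket (x + y) z = bracket x z + bracket y z"
    and bracket_add_right: "\<lbrakk>x \<in> L; y \<in> L; z \<in> L\<rbrakk> \<Longrightarrow>
      bracket x (y + z) = bracket x y + bracket x z"
    and bracket_scale_left: "\<lbrakk>x \<in> L; y \<in> L\<rbrakk> \<Longrightarrow>
      bracket (scale c x) y = scale c (bracket x y)"
    and bracket_scale_right: "\<lbrakk>x \<in> L; y \<in> L\<rbrakk> \<Longrightarrow>
      bracket x (scale c y) = scale c (bracket x y)"
    and bracket_self: "x \<in> L \<Longrightarrow> bracket x x = 0"
    and jacobi: "\<lbrakk>x \<in> L; y \<in> L; z \<in> L\<rbrakk> \<Longrightarrow>
      bracket x (bracket y z) + bracket y (bracket z x) + bracket z (bracket x y) = 0"
begin

(* A linear form on L is represented by any function on the ambient type that is linear on L;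
   its values outside L are irrelevant below. *)
definition dual_space :: "('v \<Rightarrow> 'k) set" where
  "dual_space = {\<xi>. (\<forall>x\<in>L. \<forall>y\<in>L. \<xi> (x + y) = \<xi> x + \<xi> y) \<and>
                    (\<forall>c. \<forall>x\<in>L. \<xi> (scale c x) = c * \<xi> x)}"

definition stabilizer :: "('v \<Rightarrow> 'k) \<Rightarrow> 'v set" where
  "stabilizer \<xi> = {x \<in> L. \<forall>y\<in>L. \<xi> (bracket x y) = 0}"

(* The infimum is over a nonempty set of natural numbers, hence a minimum. *)
definition lie_index :: nat where
  "lie_index = (INF \<xi>\<in>dual_space. dim (stabilizer \<xi>))"

(* Rational-valued, so that no parity of dim L + i(L) is built into the definition. *)
definition magic_number :: rat where
  "magic_number = (of_nat (dim L) + of_nat lie_index) / 2"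

definition subalgebra :: "'v set \<Rightarrow> bool" where
  "subalgebra A \<longleftrightarrow> subspace A \<and> A \<subseteq> L \<and> (\<forall>x\<in>A. \<forall>y\<in>A. bracket x y \<in> A)"

definition lie_ideal :: "'v set \<Rightarrow> bool" where
  "lie_ideal A \<longleftrightarrow> subspace A \<and> A \<subseteq> L \<and> (\<forall>x\<in>L. \<forall>y\<in>A. bracket x y \<in> A)"

definition abelian_subalgebra :: "'v set \<Rightarrow> bool" where
  "abelian_subalgebra A \<longleftrightarrow> subalgebra A \<and> (\<forall>x\<in>A. \<forall>y\<in>A. bracket x y = 0)"

definition alpha :: nat where
  "alpha = Max {dim A | A. abelian_subalgebra A}"

definition commutative_polarization :: "'v set \<Rightarrow> bool" where
  "commutative_polarization P \<longleftrightarrow> abelian_subalgebra P \<and> of_nat (dim P) = magic_number"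

end

definition mat_scale :: "'k::semiring_1 \<Rightarrow> 'k^'n^'m \<Rightarrow> 'k^'n^'m" where
  "mat_scale c A = (\<chi> i j. c * A $ i $ j)"

definition mat_bracket :: "'k::ring_1^'n^'n \<Rightarrow> 'k^'n^'n \<Rightarrow> 'k^'n^'n" where
  "mat_bracket A B = A ** B - B ** A"

(* Rows and columns are indexed by a finite linearly ordered type 'n, the order being used
   only for triangularity; n = CARD('n), which is automatically positive. *)
definition special_linear :: "('k::field^'n^'n) set" where
  "special_linear = {A. trace A = 0}"

definition upper_triangular0 :: "('k::field^'n::{finite,linorder}^'n::{finite,linorder}) set" where
  "upper_triangular0 = {A. (\<forall>i j. j < i \<longrightarrow> A $ i $ j = 0) \<and> trace A = 0}"

definition strictly_upper :: "('k::field^'n::{finite,linorder}^'n::{finite,linorder}) set" where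
  "strictly_upper = {A. \<forall>i j. j \<le> i \<longrightarrow> A $ i $ j = 0}"

lemma vector_space_mat_scale: "vector_space (mat_scale :: 'k::field \<Rightarrow> 'k^'n^'m \<Rightarrow> _)"
  by unfold_locales (simp_all add: mat_scale_def vec_eq_iff algebra_simps)

interpretation mat: vector_space "mat_scale :: 'k::field \<Rightarrow> 'k^'n^'m \<Rightarrow> _"
  by (rule vector_space_mat_scale)

lemma mat_finite_dimensional:
  "\<exists>S. finite S \<and> (L :: ('k::field^'n^'m) set) \<subseteq> mat.span S"
proof -
  define E :: "'m \<times> 'n \<Rightarrow> 'k^'n^'m"
    where "E = (\<lambda>(a, b). \<chi> i j. if i = a \<and> j = b then 1 else 0)"
  have "A \<in> mat.span (range E)" for A :: "'k^'n^'m"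
  proof -
    have "(\<Sum>p\<in>UNIV. mat_scale (A $ fst p $ snd p) (E p)) $ i $ j = A $ i $ j" for i j
    proof -
      have "(\<Sum>p\<in>UNIV. mat_scale (A $ fst p $ snd p) (E p)) $ i $ j
          = (\<Sum>p\<in>UNIV. if p = (i, j) then A $ i $ j else 0)"
        unfolding sum_component by (intro sum.cong) (auto simp: mat_scale_def E_def split: if_splits)
      then show ?thesis by simp
    qed
    then have "A = (\<Sum>p\<in>UNIV. mat_scale (A $ fst p $ snd p) (E p))"
      by (simp add: vec_eq_iff)
    moreover have "(\<Sum>p\<in>UNIV. mat_scale (A $ fst p $ snd p) (E p)) \<in> mat.span (range E)"
      by (intro mat.span_sum mat.span_scale mat.span_base) auto
    ultimately show ?thesis by simp
  qed
  then show ?thesis by (intro exI[of _ "range E"]) auto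
qed

lemma mat_fin_dim_lie_algebra:
  fixes L :: "('k::field^'n^'n) set"
  assumes "mat.subspace L" and "\<And>A B. \<lbrakk>A \<in> L; B \<in> L\<rbrakk> \<Longrightarrow> mat_bracket A B \<in> L"
  shows "fin_dim_lie_algebra mat_scale mat_bracket L"
proof -
  have sl: "mat_scale c A ** B = mat_scale c (A ** B)"
    and sr: "A ** mat_scale c B = mat_scale c (A ** B)" for c and A B :: "'k^'n^'n"
    by (simp_all add: mat_scale_def matrix_matrix_mult_def vec_eq_iff sum_distrib_left mult_ac)
  have subr: "A ** (B - C) = A ** B - A ** C"
    and subl: "(A - B) ** C = A ** C - B ** C" for A B C :: "'k^'n^'n"
    by (simp_all add: matrix_matrix_mult_def vec_eq_iff sum_subtractf algebra_simps)
  have addl: "(A + B) ** C = A ** C + B ** C" for A B C :: "'k^'n^'n"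
    by (simp add: matrix_matrix_mult_def vec_eq_iff sum.distrib algebra_simps)
  show ?thesis
    by unfold_locales
      (use assms in \<open>simp_all add: mat_finite_dimensional mat_bracket_def sl sr subl subr
        matrix_add_ldistrib addl matrix_mul_assoc
        mat.scale_right_diff_distrib\<close>)
qed

lemma trace_mat_bracket: "trace (mat_bracket A B) = (0 :: 'k::field)"
  by (simp add: mat_bracket_def trace_sub trace_mul_sym[of A B])

lemma trace_mat_scale: "trace (mat_scale c A) = c * trace (A :: 'k::field^'n^'n)"
  by (simp add: trace_def mat_scale_def sum_distrib_left)

lemma trace_zero: "trace (0 :: 'k::field^'n^'n) = 0"
  by (simp add: trace_def)

lemma mat_scale_nth: "mat_scale c A $ i $ j = c * A $ i $ j"
  by (simp add: mat_scale_def)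

lemma mat_bracket_nth: "mat_bracket A B $ i $ j = (A ** B) $ i $ j - (B ** A) $ i $ j"
  by (simp add: mat_bracket_def)

interpretation sl: fin_dim_lie_algebra mat_scale mat_bracket
    "special_linear :: ('k::field^'n^'n) set"
  by (rule mat_fin_dim_lie_algebra)
    (auto simp: mat.subspace_def special_linear_def trace_mat_bracket trace_add trace_mat_scale
      trace_zero)

lemma upper_triangular_mult:
  fixes A B :: "'k::field^'n::{finite,linorder}^'n::{finite,linorder}"
  assumes "\<And>i j. j < i \<Longrightarrow> A $ i $ j = 0" "\<And>i j. j < i \<Longrightarrow> B $ i $ j = 0" "j < i"
  shows "(A ** B) $ i $ j = 0"
proof -
  have "A $ i $ k * B $ k $ j = 0" for k
    using assms by (cases "k < i") auto
  then show ?thesis unfolding matrix_matrix_mult_def by (simp only: vec_lambda_beta sum.neutral_const)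
qed

interpretation borel_sl: fin_dim_lie_algebra mat_scale mat_bracket
    "upper_triangular0 :: ('k::field^'n::{finite,linorder}^'n::{finite,linorder}) set"
  by (rule mat_fin_dim_lie_algebra)
    (auto simp: mat.subspace_def upper_triangular0_def trace_mat_bracket trace_add
      trace_mat_scale trace_zero mat_scale_nth mat_bracket_nth upper_triangular_mult)

lemma strictly_upper_mult:
  fixes A B :: "'k::field^'n::{finite,linorder}^'n::{finite,linorder}"
  assumes "\<And>i j. j \<le> i \<Longrightarrow> A $ i $ j = 0" "\<And>i j. j \<le> i \<Longrightarrow> B $ i $ j = 0" "j \<le> i"
  shows "(A ** B) $ i $ j = 0"
proof -
  have "A $ i $ k * B $ k $ j = 0" for k
    using assms by (cases "k \<le> i") auto
  then show ?thesis unfolding matrix_matrix_mult_def by (simp only: vec_lambda_beta sum.neutral_const)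
qed

interpretation nil_sl: fin_dim_lie_algebra mat_scale mat_bracket
    "strictly_upper :: ('k::field^'n::{finite,linorder}^'n::{finite,linorder}) set"
  by (rule mat_fin_dim_lie_algebra)
    (auto simp: mat.subspace_def strictly_upper_def mat_scale_def mat_bracket_def
      strictly_upper_mult)

end

theory Submission
  imports Defs
begin

text \<open>
  The lower bounds come from one explicit space. Split the indices into the first \<open>n div 2\<close>
  and the remaining ones; the matrices living in the upper right corner (row in the first
  group, column in the second) form a space \<open>P\<close> of dimension \<open>n div 2 * (n - n div 2)\<close>, which
  is \<open>n\<^sup>2 div 4\<close>. The product of two such matrices vanishes, so \<open>P\<close> is abelian, and multiplying by
  a strictly upper triangular matrix from either side only moves entries further up or further
  right, so \<open>P\<close> is an ideal of \<open>N\<^sub>n\<close>.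

  The upper bound on all three values of \<open>\<alpha>\<close> is the theorem of Schur that a space of commuting
  \<open>n \<times> n\<close> matrices has dimension at most \<open>n\<^sup>2 div 4 + 1\<close>. An abelian subalgebra of \<open>sl(n)\<close> has
  trace zero, and in characteristic zero the identity matrix does not; adjoining it gives a
  commuting space one dimension larger, which accounts for the \<open>+ 1\<close>. Schur's theorem is
  obtained by Mirzakhani's induction. Over an algebraically closed field the space can be made
  triangular (\<open>ex_common_triangularization\<close>). Deleting the first index, or the last one, is
  multiplicative on triangular matrices and gives a smaller commuting space, with kernel the
  matrices of the space concentrated in the first row, or in the last column. For
  \<open>n \<ge> 2\<close>, commutativity makes these rows orthogonal to these columns, so the two kernels have total dimension at most
  \<open>n\<close>, and one of them at most \<open>n div 2\<close>, which is exactly the growth of \<open>n\<^sup>2 div 4\<close>.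

  It remains to see that the index of \<open>N\<^sub>n\<close> is \<open>n div 2\<close>, for then the magic number is \<open>dim P\<close>.
  For every linear form \<open>\<xi>\<close>, the space \<open>P\<close> is isotropic for \<open>(x, y) \<mapsto> \<xi>([x, y])\<close>, whence
  \<open>2 dim P \<le> dim N\<^sub>n + dim N\<^sub>n(\<xi>)\<close>; since \<open>dim N\<^sub>n = n (n - 1) / 2\<close>, this bounds the index from below.
  The bound is attained at the sum of the entries on the upper half of the antidiagonal, whose
  stabilizer consists of matrices supported on those same entries
  (\<open>stabilizer_antidiagonal_form\<close>).
\<close>

section \<open>Dimension counts in finite-dimensional vector spaces\<close>

text \<open>
  Lifts of a basis of the image, together with a basis of the kernel, span \<open>W\<close>.
\<close>

lemma (in finite_dimensional_vector_space_pair) dim_le_dim_image_plus_kernel: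
  assumes lin: "Vector_Spaces.linear s1 s2 f" and W: "vs1.subspace W"
  shows "vs1.dim W \<le> vs2.dim (f ` W) + vs1.dim {x \<in> W. f x = 0}"
proof -
  interpret lf: Vector_Spaces.linear s1 s2 f by (rule lin)
  obtain B where B: "B \<subseteq> f ` W" "vs2.independent B" "f ` W \<subseteq> vs2.span B"
    "card B = vs2.dim (f ` W)"
    using vs2.basis_exists by blast
  obtain K where K: "K \<subseteq> {x \<in> W. f x = 0}" "vs1.independent K" "{x \<in> W. f x = 0} \<subseteq> vs1.span K"
    "card K = vs1.dim {x \<in> W. f x = 0}"
    using vs1.basis_exists by blast
  have "\<forall>b\<in>B. \<exists>w\<in>W. f w = b" using B(1) by auto
  then obtain g where g: "\<And>b. b \<in> B \<Longrightarrow> g b \<in> W" "\<And>b. b \<in> B \<Longrightarrow> f (g b) = b" by metis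
  have fB: "f ` g ` B = B" using g(2) by force
  have "W \<subseteq> vs1.span (g ` B \<union> K)"
  proof
    fix w assume w: "w \<in> W"
    then have "f w \<in> f ` vs1.span (g ` B)"
      using B(3) fB lf.span_image[of "g ` B"] by auto
    then obtain c where c: "c \<in> vs1.span (g ` B)" "f w = f c" by auto
    have "c \<in> W" using c(1) vs1.span_minimal[OF _ W, of "g ` B"] g(1) by blast
    then have "w - c \<in> {x \<in> W. f x = 0}"
      using w c(2) W by (simp add: vs1.subspace_diff lf.diff)
    then have "w - c \<in> vs1.span (g ` B \<union> K)"
      using K(3) vs1.span_mono[of K "g ` B \<union> K"] by blast
    moreover have "c \<in> vs1.span (g ` B \<union> K)"
      using c(1) vs1.span_mono[of "g ` B" "g ` B \<union> K"] by blast
    ultimately show "w \<in> vs1.span (g ` B \<union> K)"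
      using vs1.span_add by fastforce
  qed
  moreover have fin: "finite B" "finite K"
    using B(2) K(2) by (auto intro: vs1.finiteI_independent vs2.finiteI_independent)
  ultimately have "vs1.dim W \<le> card (g ` B \<union> K)"
    by (intro vs1.dim_le_card) auto
  also have "\<dots> \<le> card B + card K"
    using card_Un_le[of "g ` B" K] card_image_le[OF fin(1), of g] by linarith
  finally show ?thesis using B(4) K(4) by simp
qed

context finite_dimensional_vector_space
begin

text \<open>
  The function \<open>f\<close> has to be linear on \<open>S\<close> only, because linear forms on a Lie algebra are
  represented by functions with arbitrary values outside of it.
\<close>

lemma dim_le_Suc_dim_hyperplane:
  assumes S: "subspace S"
    and add: "\<And>x y. x \<in> S \<Longrightarrow> y \<in> S \<Longrightarrow> f (x + y) = f x + f y"
    and scale: "\<And>c x. x \<in> S \<Longrightarrow> f (scale c x) = c * f x"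
  shows "dim S \<le> Suc (dim {x \<in> S. f x = 0})"
proof (cases "\<forall>x\<in>S. f x = 0")
  case True
  then have "{x \<in> S. f x = 0} = S" by auto
  then show ?thesis by simp
next
  case False
  then obtain s where s: "s \<in> S" "f s \<noteq> 0" by auto
  obtain K where K: "K \<subseteq> {x \<in> S. f x = 0}" "independent K" "{x \<in> S. f x = 0} \<subseteq> span K"
    "card K = dim {x \<in> S. f x = 0}"
    using basis_exists by blast
  have "S \<subseteq> span (insert s K)"
  proof
    fix x assume x: "x \<in> S"
    define c where "c = - (f x / f s)"
    have "f (x + scale c s) = f x + c * f s"
      using x s S by (simp only: add scale subspace_scale)
    then have "f (x + scale c s) = 0"
      using s by (simp add: c_def)
    then have "x + scale c s \<in> span K"
      using K(3) x s(1) S by (auto simp: subspace_add subspace_scale)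
    then have "x - scale (- c) s \<in> span K"
      by simp
    then show "x \<in> span (insert s K)"
      unfolding span_breakdown_eq by blast
  qed
  moreover have "finite K" using K(2) by (rule finiteI_independent)
  ultimately have "dim S \<le> card (insert s K)" by (intro dim_le_card) auto
  also have "\<dots> \<le> Suc (card K)" by (rule card_insert_le_m1[of "Suc (card K)", simplified]) simp
  finally show ?thesis using K(4) by simp
qed

lemma dim_le_card_plus_dim_hyperplanes:
  assumes S: "subspace S" and C: "finite C"
    and add: "\<And>x y c. x \<in> S \<Longrightarrow> y \<in> S \<Longrightarrow> c \<in> C \<Longrightarrow> \<psi> (x + y) c = \<psi> x c + \<psi> y c"
    and scale: "\<And>a x c. x \<in> S \<Longrightarrow> c \<in> C \<Longrightarrow> \<psi> (scale a x) c = a * \<psi> x c"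
  shows "dim S \<le> card C + dim {x \<in> S. \<forall>c\<in>C. \<psi> x c = 0}"
  using C add scale
proof (induction C rule: finite_induct)
  case empty
  then show ?case by simp
next
  case (insert d C)
  let ?S = "{x \<in> S. \<forall>c\<in>C. \<psi> x c = 0}"
  have zero: "\<psi> 0 c = 0" if "c \<in> insert d C" for c
    using insert.prems(2)[of 0 c 0] S that by (simp add: subspace_0)
  have "subspace ?S"
    using S zero insert.prems unfolding subspace_def by auto
  then have "dim ?S \<le> Suc (dim {x \<in> ?S. \<psi> x d = 0})"
    by (rule dim_le_Suc_dim_hyperplane) (use insert.prems in auto)
  also have "{x \<in> ?S. \<psi> x d = 0} = {x \<in> S. \<forall>c\<in>insert d C. \<psi> x c = 0}" by auto
  finally show ?case using insert.IH insert.prems insert.hyps by fastforce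
qed

text \<open>
  Being orthogonal to \<open>Y\<close> takes, for an element of \<open>S\<close>, only the conditions \<open>\<psi> x c = 0\<close> for \<open>c\<close>
  in a basis of a complement of \<open>T\<close> in \<open>Y\<close>, and there are \<open>dim Y - dim T\<close> of them. The lemma is
  used twice: for the orthogonality of rows and columns in Schur's bound, where the set of
  elements orthogonal to \<open>Y\<close> is trivial, and for the form \<open>\<xi>([x, y])\<close> with \<open>S = T\<close> isotropic, where
  that set lies in the stabilizer of \<open>\<xi>\<close>.
\<close>

lemma dim_orthogonal_pair_le:
  assumes S: "subspace S" and Y: "subspace Y" and TY: "T \<subseteq> Y"
    and add_left: "\<And>x x' y. x \<in> S \<Longrightarrow> x' \<in> S \<Longrightarrow> y \<in> Y \<Longrightarrow> \<psi> (x + x') y = \<psi> x y + \<psi> x' y"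
    and scale_left: "\<And>a x y. x \<in> S \<Longrightarrow> y \<in> Y \<Longrightarrow> \<psi> (scale a x) y = a * \<psi> x y"
    and add_right: "\<And>x y y'. x \<in> S \<Longrightarrow> y \<in> Y \<Longrightarrow> y' \<in> Y \<Longrightarrow> \<psi> x (y + y') = \<psi> x y + \<psi> x y'"
    and scale_right: "\<And>a x y. x \<in> S \<Longrightarrow> y \<in> Y \<Longrightarrow> \<psi> x (scale a y) = a * \<psi> x y"
    and orth: "\<And>x y. x \<in> S \<Longrightarrow> y \<in> T \<Longrightarrow> \<psi> x y = 0"
  shows "dim S + dim T \<le> dim Y + dim {x \<in> S. \<forall>y\<in>Y. \<psi> x y = 0}"
proof -
  obtain B where B: "B \<subseteq> T" "independent B" "T \<subseteq> span B" "card B = dim T"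
    using basis_exists by blast
  obtain B' where B': "B \<subseteq> B'" "B' \<subseteq> Y" "independent B'" "Y \<subseteq> span B'"
    using maximal_independent_subset_extend[of B Y] B TY by blast
  have fin: "finite B'" using B'(3) by (rule finiteI_independent)
  have cB': "card B' = dim Y"
    using B' by (intro basis_card_eq_dim) auto
  let ?C = "B' - B"
  have "dim S \<le> card ?C + dim {x \<in> S. \<forall>c\<in>?C. \<psi> x c = 0}"
    by (rule dim_le_card_plus_dim_hyperplanes) (use S fin B'(2) add_left scale_left in auto)
  also have "{x \<in> S. \<forall>c\<in>?C. \<psi> x c = 0} \<subseteq> {x \<in> S. \<forall>y\<in>Y. \<psi> x y = 0}"
  proof safe
    fix x y assume x: "x \<in> S" and C: "\<forall>c\<in>?C. \<psi> x c = 0" and y: "y \<in> Y"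
    have "\<psi> x 0 = 0" using scale_right[of x 0 0] x Y by (simp add: subspace_0)
    then have "subspace {y \<in> Y. \<psi> x y = 0}"
      using Y x unfolding subspace_def by (auto simp: add_right scale_right)
    moreover have "B' \<subseteq> {y \<in> Y. \<psi> x y = 0}"
      using B'(2) C orth[OF x] B(1) by auto
    ultimately show "\<psi> x y = 0"
      using span_minimal y B'(4) by blast
  qed
  then have "dim {x \<in> S. \<forall>c\<in>?C. \<psi> x c = 0} \<le> dim {x \<in> S. \<forall>y\<in>Y. \<psi> x y = 0}"
    by (rule dim_subset)
  moreover have "card ?C + dim T = dim Y"
    using cB' B(4) card_Diff_subset[of B B'] card_mono[OF fin B'(1)] finite_subset[OF B'(1) fin] B'(1)
    by simp
  ultimately show ?thesis by linarith
qed

end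

section \<open>Spaces of matrices\<close>

definition mat_unit :: "'m \<times> 'n \<Rightarrow> 'k::field^'n^'m" where
  "mat_unit p = (\<chi> i j. if (i, j) = p then 1 else 0)"

lemma mat_unit_nth: "mat_unit p $ i $ j = (if (i, j) = p then 1 else 0)"
  by (simp add: mat_unit_def)

lemma inj_mat_unit: "inj (mat_unit :: 'm \<times> 'n \<Rightarrow> 'k::field^'n^'m)"
proof (rule injI)
  fix p q :: "'m \<times> 'n"
  assume "(mat_unit p :: 'k^'n^'m) = mat_unit q"
  then have "(mat_unit p :: 'k^'n^'m) $ fst p $ snd p = mat_unit q $ fst p $ snd p" by simp
  then show "p = q" by (simp add: mat_unit_nth split: if_splits)
qed

definition mat_supported :: "('m \<times> 'n) set \<Rightarrow> ('k::field^'n^'m) set" where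
  "mat_supported D = {A. \<forall>i j. (i, j) \<notin> D \<longrightarrow> A $ i $ j = 0}"

lemma mat_supportedD: "A \<in> mat_supported D \<Longrightarrow> (i, j) \<notin> D \<Longrightarrow> A $ i $ j = 0"
  by (simp add: mat_supported_def)

lemma subspace_mat_supported: "mat.subspace (mat_supported D :: ('k::field^'n^'m) set)"
  by (auto simp: mat.subspace_def mat_supported_def mat_scale_nth)

lemma independent_mat_units: "mat.independent (mat_unit ` D :: ('k::field^'n^'m) set)"
proof (rule mat.independent_if_scalars_zero)
  fix f :: "'k^'n^'m \<Rightarrow> 'k" and x :: "'k^'n^'m"
  assume 0: "(\<Sum>x\<in>mat_unit ` D. mat_scale (f x) x) = 0" and x: "x \<in> mat_unit ` D"
  then obtain i j where ij: "(i, j) \<in> D" "x = mat_unit (i, j)" by auto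
  have "0 = (\<Sum>p\<in>D. mat_scale (f (mat_unit p)) (mat_unit p)) $ i $ j"
    using 0 inj_mat_unit by (simp add: sum.reindex inj_on_subset[OF inj_mat_unit] o_def)
  also have "\<dots> = (\<Sum>p\<in>D. if p = (i, j) then f (mat_unit p) else 0)"
    unfolding sum_component by (intro sum.cong) (auto simp: mat_scale_nth mat_unit_nth)
  also have "\<dots> = f x" using ij by simp
  finally show "f x = 0" ..
qed simp

lemma mat_supported_eq_span: "mat_supported D = (mat.span (mat_unit ` D) :: ('k::field^'n^'m) set)"
proof
  show "mat_supported D \<subseteq> (mat.span (mat_unit ` D) :: ('k^'n^'m) set)"
  proof
    fix A :: "'k^'n^'m" assume A: "A \<in> mat_supported D"
    have "(\<Sum>p\<in>D. mat_scale (A $ fst p $ snd p) (mat_unit p)) $ i $ j = A $ i $ j" for i j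
    proof -
      have "(\<Sum>p\<in>D. mat_scale (A $ fst p $ snd p) (mat_unit p)) $ i $ j
          = (\<Sum>p\<in>D. if p = (i, j) then A $ i $ j else 0)"
        unfolding sum_component by (intro sum.cong) (auto simp: mat_scale_nth mat_unit_nth)
      also have "\<dots> = A $ i $ j" using A by (auto simp: mat_supported_def)
      finally show ?thesis .
    qed
    then have "A = (\<Sum>p\<in>D. mat_scale (A $ fst p $ snd p) (mat_unit p))"
      by (simp add: vec_eq_iff)
    also have "\<dots> \<in> mat.span (mat_unit ` D)"
      by (intro mat.span_sum mat.span_scale mat.span_base) auto
    finally show "A \<in> mat.span (mat_unit ` D)" .
  qed
  show "mat.span (mat_unit ` D) \<subseteq> (mat_supported D :: ('k^'n^'m) set)"
    by (rule mat.span_minimal[OF _ subspace_mat_supported])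
      (auto simp: mat_supported_def mat_unit_nth)
qed

interpretation mat: finite_dimensional_vector_space
  "mat_scale :: 'k::field \<Rightarrow> 'k^'n^'m \<Rightarrow> _" "range mat_unit"
proof unfold_locales
  show "mat.independent (range mat_unit :: ('k^'n^'m) set)" by (rule independent_mat_units)
  show "mat.span (range mat_unit :: ('k^'n^'m) set) = UNIV"
    by (simp add: mat_supported_eq_span[symmetric] mat_supported_def)
qed simp

interpretation mat_pair: finite_dimensional_vector_space_pair
  "mat_scale :: 'k::field \<Rightarrow> 'k^'n^'m \<Rightarrow> _" "range mat_unit"
  "mat_scale :: 'k::field \<Rightarrow> 'k^'n^'m \<Rightarrow> _" "range mat_unit"
  ..

lemma dim_mat_supported: "mat.dim (mat_supported D :: ('k::field^'n^'m) set) = card D"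
proof -
  have "mat.dim (mat_supported D :: ('k^'n^'m) set) = card (mat_unit ` D :: ('k^'n^'m) set)"
    unfolding mat_supported_eq_span
    by (rule mat.dim_span_eq_card_independent[OF independent_mat_units])
  also have "\<dots> = card D" by (rule card_image[OF inj_on_subset[OF inj_mat_unit]]) simp
  finally show ?thesis .
qed

section \<open>Commuting triangular matrices\<close>

text \<open>
  The deleted rows and columns are filled with zeros, so that matrices of all sizes live in one
  type and the induction on the size can run over index sets.
\<close>

definition mat_compress :: "'n set \<Rightarrow> 'k::field^'n^'n \<Rightarrow> 'k^'n^'n" where
  "mat_compress J A = (\<chi> i j. if i \<in> J \<and> j \<in> J then A $ i $ j else 0)"

lemma mat_compress_nth:
  "mat_compress J A $ i $ j = (if i \<in> J \<and> j \<in> J then A $ i $ j else 0)"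
  by (simp add: mat_compress_def)

lemma linear_mat_compress:
  "Vector_Spaces.linear mat_scale mat_scale (mat_compress J :: 'k::field^'n^'n \<Rightarrow> _)"
  by unfold_locales (auto simp: vec_eq_iff mat_compress_nth mat_scale_nth)

lemma mat_mult_nth: "(A ** B) $ i $ j = (\<Sum>k\<in>UNIV. A $ i $ k * B $ k $ j)"
  by (simp add: matrix_matrix_mult_def)

lemma mat_compress_mult:
  assumes "\<And>i j k. i \<in> J \<Longrightarrow> j \<in> J \<Longrightarrow> k \<notin> J \<Longrightarrow> A $ i $ k * B $ k $ j = 0"
  shows "mat_compress J (A ** B) = mat_compress J A ** mat_compress J B"
proof -
  have "(mat_compress J A ** mat_compress J B) $ i $ j = mat_compress J (A ** B) $ i $ j" for i j
  proof (cases "i \<in> J \<and> j \<in> J")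
    case True
    have "(mat_compress J A ** mat_compress J B) $ i $ j = (\<Sum>k\<in>UNIV. A $ i $ k * B $ k $ j)"
      unfolding mat_mult_nth by (intro sum.cong) (use True assms in \<open>auto simp: mat_compress_nth\<close>)
    then show ?thesis using True by (simp add: mat_compress_nth mat_mult_nth)
  next
    case False
    then show ?thesis by (auto simp: mat_compress_nth mat_mult_nth)
  qed
  then show ?thesis by (simp add: vec_eq_iff)
qed

text \<open>
  The step of Mirzakhani's induction in numbers: the smaller of \<open>a\<close> and \<open>b\<close> is at most \<open>c div 2\<close>,
  and \<open>c\<^sup>2 div 4\<close> exceeds \<open>(c - 1)\<^sup>2 div 4\<close> by exactly \<open>c div 2\<close>.
\<close>

lemma quarter_square_step:
  fixes c d a b :: nat
  assumes "a + b \<le> c" "d \<le> (c - 1)\<^sup>2 div 4 + 1 + a" "d \<le> (c - 1)\<^sup>2 div 4 + 1 + b"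
  shows "d \<le> c\<^sup>2 div 4 + 1"
proof (cases "c = 0")
  case True
  then show ?thesis using assms by simp
next
  case False
  show ?thesis
  proof (cases "even c")
    case True
    then obtain q where q: "c = 2 * q" by (elim evenE)
    with False obtain r where r: "q = Suc r" by (cases q) auto
    have "c\<^sup>2 = 4 * q\<^sup>2" by (simp add: q power2_eq_square)
    moreover have "(c - 1)\<^sup>2 = 1 + 4 * (r\<^sup>2 + r)"
      by (simp add: q r power2_eq_square algebra_simps)
    moreover have "q\<^sup>2 = r\<^sup>2 + r + q" by (simp add: r power2_eq_square)
    ultimately show ?thesis using assms q by simp
  next
    case False
    then obtain q where q: "c = 2 * q + 1" by (elim oddE)
    have c2: "c\<^sup>2 = 1 + 4 * (q\<^sup>2 + q)" by (simp add: q power2_eq_square algebra_simps)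
    have "c\<^sup>2 div 4 = q\<^sup>2 + q" unfolding c2 by simp
    moreover have "(c - 1)\<^sup>2 = 4 * q\<^sup>2" by (simp add: q power2_eq_square)
    ultimately show ?thesis using assms q by simp
  qed
qed

text \<open>
  For \<open>A\<close> concentrated in row \<open>a\<close> and \<open>B\<close> in column \<open>b \<noteq> a\<close>, the only entry of \<open>A ** B\<close> that can be
  nonzero is the dot product of that row with that column, at position \<open>(a, b)\<close>, whereas
  \<open>B ** A\<close> vanishes there. So commutation means that the rows are orthogonal to the columns.
\<close>

lemma dim_first_row_plus_dim_last_column_le:
  fixes R C :: "('k::field^'n^'n) set"
  assumes R: "mat.subspace R" "R \<subseteq> mat_supported ({a} \<times> I)"
    and C: "C \<subseteq> mat_supported (I \<times> {b})"
    and comm: "\<And>A B. A \<in> R \<Longrightarrow> B \<in> C \<Longrightarrow> A ** B = B ** A"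
    and ab: "a \<noteq> b"
  shows "mat.dim R + mat.dim C \<le> card I"
proof -
  let ?Y = "mat_supported (I \<times> {b}) :: ('k^'n^'n) set"
  let ?\<psi> = "\<lambda>A B :: 'k^'n^'n. (A ** B) $ a $ b"
  have "mat.dim R + mat.dim C \<le> mat.dim ?Y + mat.dim {A \<in> R. \<forall>B\<in>?Y. ?\<psi> A B = 0}"
  proof (rule mat.dim_orthogonal_pair_le)
    fix A B assume A: "A \<in> R" and B: "B \<in> C"
    have "B $ a $ k * A $ k $ b = 0" for k
      using A B R(2) C ab by (cases "k = b") (auto simp: mat_supported_def subset_iff)
    then show "?\<psi> A B = 0"
      unfolding comm[OF A B] mat_mult_nth by (simp only: sum.neutral_const)
  qed (use R C subspace_mat_supported in \<open>auto simp: mat_mult_nth mat_scale_nth sum_distrib_left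
        sum.distrib[symmetric] algebra_simps\<close>)
  also have "{A \<in> R. \<forall>B\<in>?Y. ?\<psi> A B = 0} \<subseteq> {0}"
  proof safe
    fix A assume A: "A \<in> R" and orth: "\<forall>B\<in>?Y. ?\<psi> A B = 0"
    have "A $ a $ k = 0" if "k \<in> I" for k
    proof -
      have "(\<Sum>l\<in>UNIV. A $ a $ l * mat_unit (k, b) $ l $ b)
          = (\<Sum>l\<in>UNIV. if l = k then A $ a $ k else 0)"
        by (intro sum.cong) (auto simp: mat_unit_nth)
      moreover have "mat_unit (k, b) \<in> ?Y"
        using that by (auto simp: mat_supported_def mat_unit_nth)
      ultimately show ?thesis using orth by (auto simp: mat_mult_nth)
    qed
    moreover have "A $ i $ j = 0" if "(i, j) \<notin> {a} \<times> I" for i j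
      using A R(2) that by (blast dest: mat_supportedD)
    ultimately have "A $ i $ j = 0" for i j
      by (cases "(i, j) \<in> {a} \<times> I") auto
    then show "A = 0" by (simp add: vec_eq_iff)
  qed
  then have "mat.dim {A \<in> R. \<forall>B\<in>?Y. ?\<psi> A B = 0} \<le> mat.dim {0 :: 'k^'n^'n}"
    by (rule mat.dim_subset)
  finally show ?thesis
    by (simp add: dim_mat_supported card_cartesian_product)
qed

text \<open>
  Mirzakhani's induction on the size, the sizes being represented by index sets \<open>I\<close>. The case of
  a single index is separate: there the first row and the last column meet in the diagonal
  entry, and the orthogonality fails.
\<close>

lemma dim_commuting_triangular_le:
  fixes W :: "('k::field^'n::{finite,linorder}^'n::{finite,linorder}) set"
  assumes "mat.subspace W"
    and "W \<subseteq> mat_supported {(i, j). i \<in> I \<and> j \<in> I \<and> i \<le> j}"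
    and "\<And>A B. A \<in> W \<Longrightarrow> B \<in> W \<Longrightarrow> A ** B = B ** A"
  shows "mat.dim W \<le> (card I)\<^sup>2 div 4 + 1"
  using assms
proof (induction "card I" arbitrary: I W)
  case 0
  then have "I = {}" by simp
  then show ?case using mat.dim_subset[OF 0(3)] by (simp add: dim_mat_supported del: mat.dim_eq_0)
next
  case (Suc c)
  show ?case
  proof (cases "c = 0")
    case True
    have "mat.dim W \<le> mat.dim (mat_supported (I \<times> I) :: ((('k, 'n) vec, 'n) vec) set)"
      using Suc.prems(2) by (intro mat.dim_subset) (auto simp: mat_supported_def subset_iff)
    moreover have "card I = 1" using True Suc.hyps(2) by simp
    ultimately show ?thesis by (simp add: dim_mat_supported card_cartesian_product)
  next
    case False
    have I: "finite I" "I \<noteq> {}" using Suc.hyps(2) by auto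
    define a b where "a = Min I" and "b = Max I"
    have ab: "a \<in> I" "b \<in> I" "\<And>i. i \<in> I \<Longrightarrow> a \<le> i" "\<And>i. i \<in> I \<Longrightarrow> i \<le> b"
      using I by (auto simp: a_def b_def)
    have strict: "\<And>i. i \<in> I \<Longrightarrow> i \<noteq> a \<Longrightarrow> a < i" "\<And>i. i \<in> I \<Longrightarrow> i \<noteq> b \<Longrightarrow> i < b"
      using ab(3,4) by (simp_all add: order.strict_iff_order)
    have "a \<noteq> b"
    proof
      assume "a = b"
      then have "I \<subseteq> {a}" using ab by (auto intro: antisym)
      then have "card I \<le> card {a}" by (rule card_mono[rotated]) simp
      then show False using Suc.hyps(2) False by simp
    qed
    have W0: "A $ i $ j = 0" if "A \<in> W" "i \<notin> I \<or> j \<notin> I \<or> j < i" for A i j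
      using Suc.prems(2) that by (force simp: mat_supported_def subset_iff)
    let ?K = "\<lambda>J. {A \<in> W. mat_compress J A = 0}"
    have K: "mat.subspace (?K J)" for J
    proof -
      interpret Vector_Spaces.linear mat_scale mat_scale "mat_compress J :: (('k, 'n) vec, 'n) vec \<Rightarrow> _"
        by (rule linear_mat_compress)
      show ?thesis using Suc.prems(1) by (auto simp: mat.subspace_def add scale)
    qed
    have bound: "mat.dim W \<le> c\<^sup>2 div 4 + 1 + mat.dim (?K J)"
      if J: "J = I - {a} \<or> J = I - {b}" for J
    proof -
      interpret Vector_Spaces.linear mat_scale mat_scale "mat_compress J :: (('k, 'n) vec, 'n) vec \<Rightarrow> _"
        by (rule linear_mat_compress)
      have mult: "mat_compress J (A ** B) = mat_compress J A ** mat_compress J B"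
        if "A \<in> W" "B \<in> W" for A B
      proof (rule mat_compress_mult)
        fix i j k assume ijk: "i \<in> J" "j \<in> J" "k \<notin> J"
        (* The deleted index is extreme, so by triangularity no product of entries passes through it. *)
        then consider "k \<notin> I" | "k = a" "k < i" | "k = b" "j < k"
          using J ab by fastforce
        then show "A $ i $ k * B $ k $ j = 0"
          by cases (use W0 that in auto)
      qed
      have "c = card J" using J Suc.hyps(2) ab(1,2) I(1) by auto
      then have "mat.dim (mat_compress J ` W) \<le> (card J)\<^sup>2 div 4 + 1"
      proof (rule Suc.hyps(1))
        show "mat.subspace (mat_compress J ` W)" by (rule subspace_image[OF Suc.prems(1)])
        show "mat_compress J ` W \<subseteq> mat_supported {(i, j). i \<in> J \<and> j \<in> J \<and> i \<le> j}"
          using W0 by (auto simp: mat_supported_def mat_compress_nth not_le)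
        fix A B assume "A \<in> mat_compress J ` W" "B \<in> mat_compress J ` W"
        then show "A ** B = B ** A"
          using Suc.prems(3) by (auto simp: mult[symmetric])
      qed
      then show ?thesis
        using mat_pair.dim_le_dim_image_plus_kernel[OF linear_mat_compress Suc.prems(1), of J]
          \<open>c = card J\<close> by simp
    qed
    have Ka: "?K (I - {a}) \<subseteq> mat_supported ({a} \<times> I)"
    proof
      fix A assume "A \<in> ?K (I - {a})"
      then have A: "A \<in> W" "mat_compress (I - {a}) A $ i $ j = 0" for i j by simp_all
      have "A $ i $ j = 0" if "(i, j) \<notin> {a} \<times> I" for i j
        using W0[OF A(1), of i j] A(2)[of i j] that strict(1)[of i]
        by (cases "j = a") (auto simp: mat_compress_nth split: if_splits)
      then show "A \<in> mat_supported ({a} \<times> I)" by (simp add: mat_supported_def)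
    qed
    have Kb: "?K (I - {b}) \<subseteq> mat_supported (I \<times> {b})"
    proof
      fix A assume "A \<in> ?K (I - {b})"
      then have A: "A \<in> W" "mat_compress (I - {b}) A $ i $ j = 0" for i j by simp_all
      have "A $ i $ j = 0" if "(i, j) \<notin> I \<times> {b}" for i j
        using W0[OF A(1), of i j] A(2)[of i j] that strict(2)[of j]
        by (cases "i = b") (auto simp: mat_compress_nth split: if_splits)
      then show "A \<in> mat_supported (I \<times> {b})" by (simp add: mat_supported_def)
    qed
    have "mat.dim (?K (I - {a})) + mat.dim (?K (I - {b})) \<le> card I"
      by (rule dim_first_row_plus_dim_last_column_le[OF K Ka Kb _ \<open>a \<noteq> b\<close>])
        (use Suc.prems(3) in auto)
    then show ?thesis
      by (rule quarter_square_step)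
        (use bound[of "I - {a}"] bound[of "I - {b}"] Suc.hyps(2) in \<open>simp_all flip: Suc.hyps(2)\<close>)
  qed
qed

section \<open>Simultaneous triangularization\<close>

text \<open>
  The vector \<open>p(A) v\<close>.
\<close>

definition poly_act :: "'k::field^'n^'n \<Rightarrow> 'k poly \<Rightarrow> 'k^'n \<Rightarrow> 'k^'n" where
  "poly_act A p v = (\<Sum>i\<le>degree p. coeff p i *s (((*v) A ^^ i) v))"

lemma poly_act_eq:
  assumes "degree p < N"
  shows "poly_act A p v = (\<Sum>i<N. coeff p i *s (((*v) A ^^ i) v))"
  unfolding poly_act_def
  by (rule sum.mono_neutral_left) (use assms in \<open>auto simp: coeff_eq_0\<close>)

text \<open>
  This factorization is all that is needed to turn a root of an annihilating polynomial into an
  eigenvalue.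
\<close>

lemma poly_act_linear_factor:
  "poly_act A ([:- c, 1:] * q) v = A *v poly_act A q v - c *s poly_act A q v"
proof (cases "q = 0")
  case True
  then show ?thesis by (simp add: poly_act_def)
next
  case False
  let ?N = "Suc (degree q)"
  let ?P = "\<lambda>i. ((*v) A ^^ i) v"
  have q: "poly_act A q v = (\<Sum>i<?N. coeff q i *s ?P i)"
    "poly_act A q v = (\<Sum>i<Suc ?N. coeff q i *s ?P i)"
    by (rule poly_act_eq; simp)+
  have shift: "(\<Sum>i<Suc ?N. coeff (pCons 0 q) i *s ?P i) = A *v poly_act A q v"
    unfolding q(1)
    by (subst sum.lessThan_Suc_shift) (simp add: vec.sum vec.scale del: sum.lessThan_Suc)
  have "degree ([:- c, 1:] * q) < Suc ?N"
    by (subst degree_mult_eq) (use False in simp_all)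
  then have "poly_act A ([:- c, 1:] * q) v = (\<Sum>i<Suc ?N. coeff ([:- c, 1:] * q) i *s ?P i)"
    by (rule poly_act_eq)
  also have prod: "[:- c, 1:] * q = pCons 0 q - smult c q" by simp
  also have "(\<Sum>i<Suc ?N. coeff (pCons 0 q - smult c q) i *s ?P i)
      = (\<Sum>i<Suc ?N. coeff (pCons 0 q) i *s ?P i) - c *s (\<Sum>i<Suc ?N. coeff q i *s ?P i)"
    unfolding vec.scale_sum_right sum_subtractf[symmetric]
    by (intro sum.cong refl) (simp add: vec_eq_iff algebra_simps)
  finally show ?thesis unfolding prod shift q(2)[symmetric] .
qed

text \<open>
  The \<open>n + 1\<close> vectors \<open>v, A v, \<dots>, A\<^sup>n v\<close> are linearly dependent. When two of them coincide they
  no longer form a set of \<open>n + 1\<close> elements, and the dependency is written down directly.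
\<close>

lemma ex_annihilating_poly: "\<exists>p. p \<noteq> 0 \<and> poly_act (A :: 'k::field^'n^'n) p v = 0"
proof -
  let ?P = "\<lambda>i. ((*v) A ^^ i) v"
  define N where "N = CARD('n)"
  obtain u where u: "\<exists>i\<le>N. u i \<noteq> 0" "(\<Sum>i\<le>N. u i *s ?P i) = 0"
  proof (cases "inj_on ?P {..N}")
    case False
    then obtain i j where ij: "i \<le> N" "j \<le> N" "i \<noteq> j" "?P i = ?P j" by (auto simp: inj_on_def)
    let ?u = "\<lambda>l. if l = i then 1 else if l = j then -1 else 0 :: 'k"
    have "(\<Sum>l\<le>N. ?u l *s ?P l) = (\<Sum>l\<in>{i, j}. ?u l *s ?P l)"
      by (rule sum.mono_neutral_right) (use ij in auto)
    also have "\<dots> = 0" using ij by simp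
    finally have "(\<Sum>l\<le>N. ?u l *s ?P l) = 0" .
    moreover have "\<exists>l\<le>N. ?u l \<noteq> 0" using ij(1) by (intro exI[of _ i]) simp
    ultimately show thesis by (rule that[rotated])
  next
    case True
    have "vec.dependent (?P ` {..N})"
    proof (rule vec.dependent_biggerset_general)
      have "vec.dim (?P ` {..N}) \<le> CARD('n)"
        using vec.dim_subset[OF subset_UNIV, of "?P ` {..N}"] unfolding vec_dim_card .
      then show "finite (?P ` {..N}) \<Longrightarrow> vec.dim (?P ` {..N}) < card (?P ` {..N})"
        using True by (simp add: card_image N_def)
    qed
    then obtain w where w: "\<exists>x\<in>?P ` {..N}. w x \<noteq> 0" "(\<Sum>x\<in>?P ` {..N}. w x *s x) = 0"
      unfolding vec.dependent_finite[OF finite_imageI[OF finite_atMost]] by blast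
    show thesis
    proof (rule that[of "\<lambda>i. w (?P i)"])
      show "\<exists>i\<le>N. w (?P i) \<noteq> 0" using w(1) by auto
      show "(\<Sum>i\<le>N. w (?P i) *s ?P i) = 0"
        using w(2) by (simp add: sum.reindex[OF True] o_def)
    qed
  qed
  define p where "p = (\<Sum>i\<le>N. monom (u i) i)"
  have coeff: "coeff p i = (if i \<le> N then u i else 0)" for i
    by (simp add: p_def coeff_sum)
  have "degree p < Suc N"
    using degree_le[of N p] by (simp add: coeff less_Suc_eq_le)
  then have "poly_act A p v = (\<Sum>i<Suc N. u i *s ?P i)"
    by (simp add: poly_act_eq coeff)
  then have "poly_act A p v = 0" using u(2) by (simp add: lessThan_Suc_atMost)
  moreover have "p \<noteq> 0" using u(1) coeff by (metis coeff_0)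
  ultimately show ?thesis by blast
qed

text \<open>
  An eigenvector of the operator induced on the quotient \<open>V / U\<close>, phrased without quotients: take
  \<open>p\<close> of least degree with \<open>p(A) v \<in> U\<close> and split off a linear factor, \<open>p = (X - c) q\<close>. Then
  \<open>q(A) v\<close> lies outside of \<open>U\<close>, and \<open>A - c\<close> maps it into \<open>U\<close>.
\<close>

lemma ex_eigenvector_mod_subspace:
  fixes A :: "'k::alg_closed_field^'n^'n"
  assumes V: "vec.subspace V" "\<And>x. x \<in> V \<Longrightarrow> A *v x \<in> V"
    and U: "vec.subspace U" and v: "v \<in> V" "v \<notin> U"
  shows "\<exists>c. \<exists>w\<in>V - U. A *v w - c *s w \<in> U"
proof -
  have "\<exists>p. p \<noteq> 0 \<and> poly_act A p v \<in> U"
    using ex_annihilating_poly[of A v] vec.subspace_0[OF U] by auto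
  then obtain p where p: "p \<noteq> 0" "poly_act A p v \<in> U"
    and min: "\<And>q. q \<noteq> 0 \<Longrightarrow> poly_act A q v \<in> U \<Longrightarrow> degree p \<le> degree q"
    using ex_has_least_nat[of "\<lambda>p. p \<noteq> 0 \<and> poly_act A p v \<in> U" _ degree] by blast
  have "degree p \<noteq> 0"
  proof
    assume 0: "degree p = 0"
    then have "poly_act A p v = coeff p 0 *s v" by (simp add: poly_act_def)
    moreover have "coeff p 0 \<noteq> 0" using 0 p(1) leading_coeff_0_iff[of p] by simp
    ultimately have "v = inverse (coeff p 0) *s poly_act A p v" by (simp add: vec.scale_scale)
    then show False using v(2) vec.subspace_scale[OF U p(2)] by metis
  qed
  then obtain c where "poly p c = 0" using alg_closed_imp_poly_has_root[of p] by auto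
  then obtain q where q: "p = [:- c, 1:] * q" unfolding poly_eq_0_iff_dvd by (elim dvdE)
  with p(1) have "q \<noteq> 0" by auto
  then have "degree p = Suc (degree q)" by (simp add: q degree_mult_eq del: mult_pCons_left)
  then have "poly_act A q v \<notin> U" using min[OF \<open>q \<noteq> 0\<close>] by auto
  moreover have "((*v) A ^^ i) v \<in> V" for i by (induction i) (use v V in auto)
  then have "poly_act A q v \<in> V" unfolding poly_act_def
    by (intro vec.subspace_sum vec.subspace_scale V(1))
  moreover have "A *v poly_act A q v - c *s poly_act A q v \<in> U"
    using p(2) by (simp only: q poly_act_linear_factor)
  ultimately show ?thesis by blast
qed

text \<open>
  Among the invariant subspaces strictly above \<open>U\<close> choose a minimal one, \<open>V\<close>. For each \<open>A \<in> W\<close> some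
  eigenspace of \<open>A\<close> on \<open>V / U\<close> is nonzero, and it is invariant because \<open>W\<close> commutes; by minimality
  it is everything. So each \<open>A\<close> is a scalar on \<open>V / U\<close>, and any vector of \<open>V - U\<close> will do.
\<close>

lemma ex_common_eigenvector_mod_subspace:
  fixes W :: "('k::alg_closed_field^'n^'n) set"
  assumes comm: "\<And>A B. A \<in> W \<Longrightarrow> B \<in> W \<Longrightarrow> A ** B = B ** A"
    and U: "vec.subspace U" "\<And>A x. A \<in> W \<Longrightarrow> x \<in> U \<Longrightarrow> A *v x \<in> U" "U \<noteq> UNIV"
  shows "\<exists>v. v \<notin> U \<and> (\<forall>A\<in>W. \<exists>c. A *v v - c *s v \<in> U)"
proof -
  define inv where "inv V \<longleftrightarrow> vec.subspace V \<and> U \<subset> V \<and> (\<forall>A\<in>W. \<forall>x\<in>V. A *v x \<in> V)"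
    for V :: "('k, 'n) vec set"
  have "inv UNIV" using U by (auto simp: inv_def)
  from ex_has_least_nat[of inv, OF this, of vec.dim]
  obtain V where "inv V" and min: "\<And>V'. inv V' \<Longrightarrow> vec.dim V \<le> vec.dim V'"
    by metis
  then have V: "vec.subspace V" "U \<subset> V" "\<And>A x. A \<in> W \<Longrightarrow> x \<in> V \<Longrightarrow> A *v x \<in> V"
    by (auto simp: inv_def)
  obtain v where v: "v \<in> V" "v \<notin> U" using V(2) by blast
  have "\<exists>c. A *v v - c *s v \<in> U" if A: "A \<in> W" for A
  proof -
    obtain c w where w: "w \<in> V - U" "A *v w - c *s w \<in> U"
      using ex_eigenvector_mod_subspace[OF V(1) V(3)[OF A] U(1) v] by blast
    let ?V' = "{x \<in> V. A *v x - c *s x \<in> U}"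
    have "inv ?V'"
      unfolding inv_def
    proof (intro conjI ballI)
      show "vec.subspace ?V'"
      proof (rule vec.subspaceI)
        show "0 \<in> ?V'" using V(1) U(1) by (simp add: vec.subspace_0)
      next
        fix x y assume xy: "x \<in> ?V'" "y \<in> ?V'"
        have "A *v (x + y) - c *s (x + y) = (A *v x - c *s x) + (A *v y - c *s y)"
          by (simp add: vec.add vec.scale_right_distrib)
        then show "x + y \<in> ?V'"
          using xy V(1) U(1) by (simp add: vec.subspace_add)
      next
        fix a x assume x: "x \<in> ?V'"
        have "A *v (a *s x) - c *s (a *s x) = a *s (A *v x - c *s x)"
          by (simp add: vec.scale vec.scale_right_diff_distrib vec.scale_left_commute)
        then show "a *s x \<in> ?V'"
          using x V(1) U(1) by (simp add: vec.subspace_scale)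
      qed
      have "U \<subseteq> ?V'"
        using V(2) U(2)[OF A] U(1) by (auto intro!: vec.subspace_diff vec.subspace_scale)
      then show "U \<subset> ?V'" using w by auto
      fix B x assume B: "B \<in> W" and x: "x \<in> ?V'"
      have "A *v (B *v x) - c *s (B *v x) = B *v (A *v x - c *s x)"
        by (simp add: vec.diff vec.scale matrix_vector_mul_assoc comm[OF A B])
      then show "B *v x \<in> ?V'" using x V(3)[OF B] U(2)[OF B] by simp
    qed
    then have "vec.dim V \<le> vec.dim ?V'" by (rule min)
    moreover have "vec.subspace ?V'" using \<open>inv ?V'\<close> by (simp add: inv_def)
    ultimately have "?V' = V"
      by (intro vec.subspace_dim_equal) (use V(1) in auto)
    then show ?thesis using v(1) by blast
  qed
  then show ?thesis using v(2) by blast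
qed

text \<open>
  The basis is built by recursion along the index order: the vectors chosen so far span an
  invariant subspace of dimension less than \<open>n\<close>, and the next one is a common eigenvector
  modulo that subspace.
\<close>

lemma ex_common_triangularizing_basis:
  fixes W :: "('k::alg_closed_field^'n::{finite,linorder}^'n::{finite,linorder}) set"
  assumes comm: "\<And>A B. A \<in> W \<Longrightarrow> B \<in> W \<Longrightarrow> A ** B = B ** A"
  shows "\<exists>v :: 'n \<Rightarrow> ('k, 'n) vec. \<forall>j. v j \<notin> vec.span (v ` {..<j}) \<and>
    (\<forall>A\<in>W. A *v v j \<in> vec.span (v ` {..j}))"
proof -
  let ?P = "\<lambda>(f :: 'n \<Rightarrow> ('k, 'n) vec) j r. r \<notin> vec.span (f ` {..<j}) \<and>
    (\<forall>A\<in>W. A *v r \<in> vec.span (insert r (f ` {..<j})))"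
  have "\<exists>v. \<forall>j. ?P v j (v j)"
  proof (rule dependent_wf_choice[where R = "{(i, j :: 'n). i < j}"])
    show "wf {(i, j :: 'n). i < j}"
      by (rule wf_subset[OF wf_measure[of "\<lambda>i. card {..<i}"]]) (auto intro!: psubset_card_mono)
  next
    fix f g :: "'n \<Rightarrow> ('k, 'n) vec" and j r
    assume "\<And>i. (i, j) \<in> {(i, j). i < j} \<Longrightarrow> f i = g i"
    then have "f ` {..<j} = g ` {..<j}" by (intro image_cong) auto
    then show "?P f j r = ?P g j r" by simp
  next
    fix j :: 'n and f :: "'n \<Rightarrow> ('k, 'n) vec"
    assume IH: "\<And>i. (i, j) \<in> {(i, j). i < j} \<Longrightarrow> ?P f i (f i)"
    let ?U = "vec.span (f ` {..<j})"
    have inv: "A *v x \<in> ?U" if A: "A \<in> W" and x: "x \<in> ?U" for A x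
    proof -
      have "A *v f i \<in> ?U" if "i < j" for i
      proof -
        have "A *v f i \<in> vec.span (insert (f i) (f ` {..<i}))" using IH A that by auto
        moreover have "insert (f i) (f ` {..<i}) \<subseteq> f ` {..<j}" using that by auto
        ultimately show ?thesis using vec.span_mono by blast
      qed
      then have "(*v) A ` f ` {..<j} \<subseteq> ?U" by auto
      then have "vec.span ((*v) A ` f ` {..<j}) \<subseteq> ?U"
        by (rule vec.span_minimal) (rule vec.subspace_span)
      then show ?thesis using x by (auto simp: vec.span_image)
    qed
    have "card (f ` {..<j}) < CARD('n)"
    proof -
      have "card {..<j} < card (UNIV :: 'n set)" by (rule psubset_card_mono) auto
      then show ?thesis using card_image_le[of "{..<j}" f] by simp
    qed
    then have "vec.dim ?U < CARD('n)"
      using vec.dim_le_card'[of "f ` {..<j}"] by simp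
    then have "vec.dim ?U \<noteq> vec.dim (UNIV :: ('k, 'n) vec set)"
      unfolding vec_dim_card by (rule less_imp_neq)
    then have "?U \<noteq> UNIV" by metis
    then obtain r where r: "r \<notin> ?U" "\<And>A. A \<in> W \<Longrightarrow> \<exists>c. A *v r - c *s r \<in> ?U"
      using ex_common_eigenvector_mod_subspace[of W ?U] comm inv vec.subspace_span by blast
    have "A *v r \<in> vec.span (insert r (f ` {..<j}))" if "A \<in> W" for A
      using r(2)[OF that] unfolding vec.span_breakdown_eq .
    then show "\<exists>r. ?P f j r" using r(1) by blast
  qed
  then obtain v where v: "\<And>j. ?P v j (v j)" by blast
  moreover have "insert (v j) (v ` {..<j}) = v ` {..j}" for j
    by (auto simp: le_less)
  ultimately show ?thesis by (intro exI[of _ v]) auto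
qed

text \<open>
  The columns of \<open>Q\<close> are the vectors of the triangularizing basis.
\<close>

lemma ex_common_triangularization:
  fixes W :: "('k::alg_closed_field^'n::{finite,linorder}^'n::{finite,linorder}) set"
  assumes comm: "\<And>A B. A \<in> W \<Longrightarrow> B \<in> W \<Longrightarrow> A ** B = B ** A"
  shows "\<exists>Q R :: (('k, 'n) vec, 'n) vec. Q ** R = mat 1 \<and> R ** Q = mat 1 \<and>
    (\<forall>A\<in>W. R ** A ** Q \<in> mat_supported {(i, j). i \<le> j})"
proof -
  obtain v :: "'n \<Rightarrow> ('k, 'n) vec" where
    indep: "\<And>j. v j \<notin> vec.span (v ` {..<j})" and
    tri: "\<And>A j. A \<in> W \<Longrightarrow> A *v v j \<in> vec.span (v ` {..j})"
    using ex_common_triangularizing_basis[OF comm, of W] by auto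
  define Q where "Q = (\<chi> i j. v j $ i)"
  have col: "column j Q = v j" for j by (simp add: Q_def column_def vec_eq_iff)
  have "x = 0" if x: "Q *v x = 0" for x
  proof (rule ccontr)
    assume "x \<noteq> 0"
    (* Solving the relation for the vector with the largest index puts it in the span of the
       earlier ones. *)
    define j where "j = Max {i. x $ i \<noteq> 0}"
    have "{i. x $ i \<noteq> 0} \<noteq> {}" using \<open>x \<noteq> 0\<close> by (auto simp: vec_eq_iff)
    then have j: "x $ j \<noteq> 0" "\<And>i. x $ i \<noteq> 0 \<Longrightarrow> i \<le> j"
      using Max_in[of "{i. x $ i \<noteq> 0}"] by (auto simp: j_def)
    have "0 = (\<Sum>i\<in>UNIV. x $ i *s v i)"
      using x by (simp add: matrix_mult_sum col)
    also have "\<dots> = x $ j *s v j + (\<Sum>i\<in>UNIV - {j}. x $ i *s v i)"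
      by (simp add: sum.remove[of UNIV j])
    also have "(\<Sum>i\<in>UNIV - {j}. x $ i *s v i) = (\<Sum>i<j. x $ i *s v i)"
      by (rule sum.mono_neutral_right) (use j(2) in \<open>fastforce simp: not_less\<close>)+
    finally have "x $ j *s v j = - (\<Sum>i<j. x $ i *s v i)" by (simp add: eq_neg_iff_add_eq_0)
    then have "v j = inverse (x $ j) *s (- (\<Sum>i<j. x $ i *s v i))"
      using j(1) by (metis left_inverse vec.scale_one vec.scale_scale)
    also have "\<dots> \<in> vec.span (v ` {..<j})"
      by (intro vec.span_scale vec.span_neg vec.span_sum vec.span_base) auto
    finally show False using indep by blast
  qed
  then obtain R where R: "R ** Q = mat 1"
    using matrix_left_invertible_ker[of Q] by blast
  have Rv: "R *v v i = axis i 1" for i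
  proof -
    have "(R ** Q) *v axis i 1 = axis i 1" by (simp add: R)
    moreover have "Q *v axis i 1 = v i"
      by (simp add: vec_eq_iff Q_def matrix_vector_mult_def axis_def if_distrib cong: if_cong)
    ultimately show ?thesis by (simp flip: matrix_vector_mul_assoc)
  qed
  have "(R ** A ** Q) $ i $ j = 0" if A: "A \<in> W" and ij: "j < i" for A i j
  proof -
    let ?L = "{x :: ('k, 'n) vec. x $ i = 0}"
    have L: "vec.subspace ?L" by (auto simp: vec.subspace_def)
    have "(*v) R ` v ` {..j} \<subseteq> ?L" using ij by (auto simp: Rv axis_def)
    then have "vec.span ((*v) R ` v ` {..j}) \<subseteq> ?L" by (rule vec.span_minimal[OF _ L])
    then have "R *v (A *v v j) \<in> ?L" using tri[OF A, of j] by (auto simp: vec.span_image)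
    moreover have "R *v (A *v v j) = column j (R ** A ** Q)"
      by (simp add: matrix_vector_mul_assoc vec_eq_iff column_def)
        (simp add: matrix_matrix_mult_def matrix_vector_mult_def Q_def)
    ultimately show ?thesis by (simp add: column_def)
  qed
  then have "\<forall>A\<in>W. R ** A ** Q \<in> mat_supported {(i, j). i \<le> j}"
    by (auto simp: mat_supported_def not_le)
  then show ?thesis using R matrix_left_right_inverse[of R Q] by blast
qed

section \<open>The bound of Schur\<close>

text \<open>
  Conjugation by the triangularizing matrix preserves dimension and commutation, which reduces
  the bound to the triangular case.
\<close>

proposition dim_commuting_matrices_le:
  fixes W :: "('k::alg_closed_field^'n::{finite,linorder}^'n::{finite,linorder}) set"
  assumes W: "mat.subspace W"
    and comm: "\<And>A B. A \<in> W \<Longrightarrow> B \<in> W \<Longrightarrow> A ** B = B ** A"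
  shows "mat.dim W \<le> CARD('n)\<^sup>2 div 4 + 1"
proof -
  obtain Q R :: "(('k, 'n) vec, 'n) vec" where QR: "Q ** R = mat 1" "R ** Q = mat 1"
    and tri: "\<And>A. A \<in> W \<Longrightarrow> R ** A ** Q \<in> mat_supported {(i, j). i \<le> j}"
    using ex_common_triangularization[OF comm, of W] by auto
  let ?f = "\<lambda>A. R ** A ** Q"
  have lin: "Vector_Spaces.linear mat_scale mat_scale ?f"
    by unfold_locales (simp_all add: vec_eq_iff mat_mult_nth mat_scale_nth sum.distrib[symmetric]
        sum_distrib_left sum_distrib_right algebra_simps)
  have conj_back: "Q ** ?f A ** R = A" for A
  proof -
    have "Q ** ?f A ** R = (Q ** R) ** A ** (Q ** R)" by (simp only: matrix_mul_assoc)
    then show ?thesis by (simp add: QR(1))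
  qed
  then have inj: "inj ?f" by (intro inj_on_inverseI[where g = "\<lambda>X. Q ** X ** R"])
  have mult: "?f A ** ?f B = ?f (A ** B)" for A B
  proof -
    have "?f A ** ?f B = R ** A ** (Q ** R) ** B ** Q" by (simp add: matrix_mul_assoc)
    then show ?thesis by (simp add: QR(1) matrix_mul_assoc)
  qed
  have "mat.dim W = mat.dim (?f ` W)"
    by (rule mat_pair.dim_image_eq[OF lin, symmetric]) (rule inj_on_subset[OF inj], simp)
  also have "\<dots> \<le> (card (UNIV :: 'n set))\<^sup>2 div 4 + 1"
  proof (rule dim_commuting_triangular_le)
    interpret Vector_Spaces.linear mat_scale mat_scale ?f by (rule lin)
    show "mat.subspace (?f ` W)" by (rule subspace_image[OF W])
  qed (use tri comm in \<open>auto simp: mult\<close>)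
  finally show ?thesis .
qed

text \<open>
  The identity matrix commutes with everything and has trace \<open>n \<noteq> 0\<close>, so it enlarges \<open>W\<close> by one
  dimension.
\<close>

lemma dim_commuting_traceless_le:
  fixes W :: "('k::{alg_closed_field,field_char_0}^'n::{finite,linorder}^'n::{finite,linorder}) set"
  assumes W: "mat.subspace W"
    and comm: "\<And>A B. A \<in> W \<Longrightarrow> B \<in> W \<Longrightarrow> A ** B = B ** A"
    and traceless: "\<And>A. A \<in> W \<Longrightarrow> trace A = 0"
  shows "mat.dim W \<le> CARD('n)\<^sup>2 div 4"
proof -
  let ?W = "mat.span (insert (mat 1) W)"
  have "mat.subspace {X. X ** Y = Y ** X}" for Y :: "(('k, 'n) vec, 'n) vec"
    by (auto simp: mat.subspace_def vec_eq_iff mat_mult_nth mat_scale_nth sum.distrib algebra_simps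
        simp flip: sum_distrib_left)
  then have cent: "?W \<subseteq> {X. X ** Y = Y ** X}" if "insert (mat 1) W \<subseteq> {X. X ** Y = Y ** X}" for Y
    using mat.span_minimal that by blast
  have "X ** Y = Y ** X" if "X \<in> ?W" "Y \<in> insert (mat 1) W" for X Y
    using cent[of Y] that comm by auto
  then have "insert (mat 1) W \<subseteq> {Y. Y ** X = X ** Y}" if "X \<in> ?W" for X
    using that by (metis (mono_tags, lifting) mem_Collect_eq subsetI)
  then have "X ** Y = Y ** X" if "X \<in> ?W" "Y \<in> ?W" for X Y
    using cent[of X] that by auto
  then have "mat.dim ?W \<le> CARD('n)\<^sup>2 div 4 + 1"
    by (intro dim_commuting_matrices_le mat.subspace_span)
  moreover have "trace (mat 1 :: (('k, 'n) vec, 'n) vec) \<noteq> 0"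
    by (simp add: trace_def mat_def)
  then have "mat 1 \<notin> W" using traceless by blast
  then have "mat 1 \<notin> mat.span W" using W by (metis mat.span_eq_iff)
  then have "mat.dim ?W = mat.dim W + 1" by (simp add: mat.dim_insert)
  ultimately show ?thesis by simp
qed

section \<open>Abelian subalgebras and stabilizers in matrix Lie algebras\<close>

lemma abelian_subalgebra_commute:
  assumes "fin_dim_lie_algebra mat_scale mat_bracket (L :: ('k::field^'n^'n) set)"
    and "fin_dim_lie_algebra.abelian_subalgebra mat_scale mat_bracket L A" "X \<in> A" "Y \<in> A"
  shows "X ** Y = Y ** X"
proof -
  interpret L: fin_dim_lie_algebra mat_scale mat_bracket L by (rule assms(1))
  show ?thesis using assms(2-4) by (auto simp: L.abelian_subalgebra_def mat_bracket_def)
qed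

lemma alpha_eqI:
  fixes L :: "('k::{alg_closed_field,field_char_0}^'n::{finite,linorder}^'n::{finite,linorder}) set"
  assumes L: "fin_dim_lie_algebra mat_scale mat_bracket L" and sl: "L \<subseteq> special_linear"
    and P: "fin_dim_lie_algebra.abelian_subalgebra mat_scale mat_bracket L P"
    and dimP: "mat.dim P = CARD('n)\<^sup>2 div 4"
  shows "fin_dim_lie_algebra.alpha mat_scale mat_bracket L = CARD('n)\<^sup>2 div 4"
proof -
  interpret L: fin_dim_lie_algebra mat_scale mat_bracket L by (rule L)
  have le: "mat.dim A \<le> CARD('n)\<^sup>2 div 4" if A: "L.abelian_subalgebra A" for A
  proof (rule dim_commuting_traceless_le)
    show "mat.subspace A" using A by (simp add: L.abelian_subalgebra_def L.subalgebra_def)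
    show "X ** Y = Y ** X" if "X \<in> A" "Y \<in> A" for X Y
      using abelian_subalgebra_commute[OF L A that] .
    show "trace X = 0" if "X \<in> A" for X
      using A that sl
      by (auto simp: L.abelian_subalgebra_def L.subalgebra_def special_linear_def)
  qed
  show ?thesis
    unfolding L.alpha_def
  proof (rule Max_eqI)
    show "finite {mat.dim A |A. L.abelian_subalgebra A}"
      by (rule finite_subset[of _ "{..CARD('n)\<^sup>2 div 4}"]) (use le in auto)
    show "CARD('n)\<^sup>2 div 4 \<in> {mat.dim A |A. L.abelian_subalgebra A}"
      using P dimP by (intro CollectI exI[of _ P]) simp
  qed (use le in auto)
qed

text \<open>
  An abelian subalgebra \<open>P\<close> is isotropic for the alternating form \<open>\<xi>([x, y])\<close> on \<open>L\<close>, whose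
  radical is the stabilizer of \<open>\<xi>\<close>. In particular no abelian subalgebra is larger than the
  magic number.
\<close>

lemma dim_abelian_subalgebra_le:
  assumes L: "fin_dim_lie_algebra mat_scale mat_bracket (L :: ('k::field^'n^'n) set)"
    and P: "fin_dim_lie_algebra.abelian_subalgebra mat_scale mat_bracket L P"
    and \<xi>: "\<xi> \<in> fin_dim_lie_algebra.dual_space mat_scale L"
  shows "2 * mat.dim P \<le> mat.dim L
    + mat.dim (fin_dim_lie_algebra.stabilizer mat_bracket L \<xi>)"
proof -
  interpret L: fin_dim_lie_algebra mat_scale mat_bracket L by (rule L)
  have P': "mat.subspace P" "P \<subseteq> L" "\<And>x y. x \<in> P \<Longrightarrow> y \<in> P \<Longrightarrow> mat_bracket x y = 0"
    using P by (auto simp: L.abelian_subalgebra_def L.subalgebra_def)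
  have add: "\<xi> (x + y) = \<xi> x + \<xi> y" and scale: "\<xi> (mat_scale c x) = c * \<xi> x"
    if "x \<in> L" "y \<in> L" for x y c
    using \<xi> that by (auto simp: L.dual_space_def)
  have "\<xi> 0 = 0"
    using scale[of 0 0 0] L.subspace_carrier by (simp add: mat.subspace_0)
  have "mat.dim P + mat.dim P
      \<le> mat.dim L + mat.dim {x \<in> P. \<forall>y\<in>L. \<xi> (mat_bracket x y) = 0}"
    by (rule mat.dim_orthogonal_pair_le)
      (use P' L.subspace_carrier \<open>\<xi> 0 = 0\<close> in \<open>simp_all add: subset_iff add scale
        L.bracket_closed L.bracket_add_left L.bracket_add_right L.bracket_scale_left
        L.bracket_scale_right\<close>)
  also have "{x \<in> P. \<forall>y\<in>L. \<xi> (mat_bracket x y) = 0} \<subseteq> L.stabilizer \<xi>"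
    using P'(2) by (auto simp: L.stabilizer_def)
  then have "mat.dim {x \<in> P. \<forall>y\<in>L. \<xi> (mat_bracket x y) = 0} \<le> mat.dim (L.stabilizer \<xi>)"
    by (rule mat.dim_subset)
  finally show ?thesis by simp
qed

section \<open>The corner ideal\<close>

text \<open>
  The position of an index, counted from 0; it makes the halves and the reversal of the index
  type expressible by arithmetic.
\<close>

definition rank_of :: "'n::{finite,linorder} \<Rightarrow> nat" where
  "rank_of i = card {..<i}"

lemma rank_of_less_iff: "rank_of i < rank_of j \<longleftrightarrow> i < j"
proof -
  have *: "rank_of i < rank_of j" if "i < j" for i j :: 'a
    unfolding rank_of_def by (rule psubset_card_mono) (use that in auto)
  then show ?thesis by (metis linorder_neqE order_less_asym)
qed

lemma rank_of_eq_iff: "rank_of i = rank_of j \<longleftrightarrow> i = j"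
  by (metis linorder_neqE nat_neq_iff rank_of_less_iff)

lemma rank_of_less_CARD: "rank_of (i :: 'n::{finite,linorder}) < CARD('n)"
  unfolding rank_of_def by (rule psubset_card_mono) auto

lemma range_rank_of: "range (rank_of :: 'n::{finite,linorder} \<Rightarrow> nat) = {..<CARD('n)}"
proof (rule card_subset_eq)
  have "inj (rank_of :: 'n \<Rightarrow> nat)" by (simp add: inj_def rank_of_eq_iff)
  then show "card (range (rank_of :: 'n \<Rightarrow> nat)) = card {..<CARD('n)}"
    by (simp add: card_image)
qed (auto simp: rank_of_less_CARD)

lemma ex_rank_of: "r < CARD('n) \<Longrightarrow> \<exists>i :: 'n::{finite,linorder}. rank_of i = r"
  using range_rank_of[where 'n='n] by (metis imageE lessThan_iff)

lemma card_rank_of_less: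
  assumes "m \<le> CARD('n)"
  shows "card {i :: 'n::{finite,linorder}. rank_of i < m} = m"
proof -
  have "card {i :: 'n. rank_of i < m} = card (rank_of ` {i :: 'n. rank_of i < m})"
    by (rule card_image[symmetric]) (simp add: inj_on_def rank_of_eq_iff)
  also have "rank_of ` {i :: 'n. rank_of i < m} = {..<m}"
  proof
    show "{..<m} \<subseteq> rank_of ` {i :: 'n. rank_of i < m}"
    proof
      fix r assume r: "r \<in> {..<m}"
      then obtain i :: 'n where "rank_of i = r" using assms ex_rank_of[where 'n = 'n, of r] by auto
      with r show "r \<in> rank_of ` {i :: 'n. rank_of i < m}" by auto
    qed
  qed auto
  finally show ?thesis by simp
qed

definition corner :: "('n::{finite,linorder} \<times> 'n) set" where
  "corner = {i. rank_of i < CARD('n) div 2} \<times> {j. CARD('n) div 2 \<le> rank_of j}"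

lemma quarter_square: "(n::nat) div 2 * (n - n div 2) = n\<^sup>2 div 4"
proof (cases "even n")
  case True
  then obtain q where "n = 2 * q" by (elim evenE)
  then show ?thesis by (simp add: power2_eq_square)
next
  case False
  then obtain q where q: "n = 2 * q + 1" by (elim oddE)
  have n2: "n\<^sup>2 = 1 + 4 * (q * (q + 1))" by (simp add: q power2_eq_square algebra_simps)
  have "n\<^sup>2 div 4 = q * (q + 1)" unfolding n2 by simp
  then show ?thesis by (simp add: q)
qed

lemma card_corner: "card (corner :: ('n::{finite,linorder} \<times> 'n) set) = CARD('n)\<^sup>2 div 4"
proof -
  let ?m = "CARD('n) div 2"
  have "{j :: 'n. ?m \<le> rank_of j} = UNIV - {j. rank_of j < ?m}" by auto
  then have "card {j :: 'n. ?m \<le> rank_of j} = CARD('n) - ?m"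
    by (simp add: card_Diff_subset card_rank_of_less)
  then show ?thesis
    by (simp add: corner_def card_cartesian_product card_rank_of_less quarter_square)
qed

text \<open>
  An intermediate index would have to lie in both halves.
\<close>

lemma corner_mult_zero:
  fixes A B :: "'k::field^'n::{finite,linorder}^'n::{finite,linorder}"
  assumes "A \<in> mat_supported corner" "B \<in> mat_supported corner"
  shows "A ** B = 0"
proof -
  have "A $ i $ k * B $ k $ j = 0" for i j k
    using assms by (cases "rank_of k < CARD('n) div 2") (auto simp: mat_supported_def corner_def)
  then show ?thesis
    unfolding vec_eq_iff mat_mult_nth by (simp only: sum.neutral_const zero_index) simp
qed

lemma strictly_upper_eq: "strictly_upper = mat_supported {(i, j). i < j}"
  by (auto simp: strictly_upper_def mat_supported_def not_less)

lemma strictly_upper_subset_upper_triangular0: "strictly_upper \<subseteq> upper_triangular0"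
  by (auto simp: strictly_upper_def upper_triangular0_def trace_def)

lemma upper_triangular0_subset_special_linear: "upper_triangular0 \<subseteq> special_linear"
  by (auto simp: upper_triangular0_def special_linear_def)

lemma mat_supported_corner_subset:
  "mat_supported corner
    \<subseteq> (strictly_upper :: ('k::field^'n::{finite,linorder}^'n::{finite,linorder}) set)"
proof -
  have "(corner :: ('n \<times> 'n) set) \<subseteq> {(i, j). i < j}"
    by (auto simp: corner_def simp flip: rank_of_less_iff)
  then show ?thesis by (auto simp: strictly_upper_eq mat_supported_def)
qed

lemma abelian_subalgebra_corner:
  assumes "fin_dim_lie_algebra mat_scale mat_bracket
      (L :: ('k::field^'n::{finite,linorder}^'n::{finite,linorder}) set)"
    and "strictly_upper \<subseteq> L"
  shows "fin_dim_lie_algebra.abelian_subalgebra mat_scale mat_bracket L (mat_supported corner)"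
proof -
  interpret L: fin_dim_lie_algebra mat_scale mat_bracket L by (rule assms(1))
  have "mat_bracket A B = 0" if "A \<in> mat_supported corner" "B \<in> mat_supported corner" for A B :: "(('k, 'n) vec, 'n) vec"
    using that by (simp add: mat_bracket_def corner_mult_zero)
  then show ?thesis
    using assms(2) mat_supported_corner_subset subspace_mat_supported[of corner, where 'k='k]
    by (auto simp: L.abelian_subalgebra_def L.subalgebra_def mat.subspace_0)
qed

lemma lie_ideal_corner:
  "nil_sl.lie_ideal (mat_supported corner
    :: ('k::field^'n::{finite,linorder}^'n::{finite,linorder}) set)"
  unfolding nil_sl.lie_ideal_def
proof (intro conjI ballI)
  fix A B :: "(('k, 'n) vec, 'n) vec"
  assume A: "A \<in> strictly_upper" and B: "B \<in> mat_supported corner"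
  have "(A ** B) $ i $ j = 0 \<and> (B ** A) $ i $ j = 0" if ij: "(i, j) \<notin> corner" for i j
  proof -
    have A0: "A $ i $ k = 0" if "rank_of k \<le> rank_of i" for i k
      using A that by (simp add: strictly_upper_def not_less[symmetric] rank_of_less_iff)
    have B0: "B $ i $ k = 0" if "CARD('n) div 2 \<le> rank_of i \<or> rank_of k < CARD('n) div 2" for i k
      using B that by (auto simp: mat_supported_def corner_def)
    have "A $ i $ k * B $ k $ j = 0 \<and> B $ i $ k * A $ k $ j = 0" for k
      using A0[of k i] A0[of j k] B0[of k j] B0[of i k] ij by (fastforce simp: corner_def)
    then show ?thesis unfolding mat_mult_nth by (intro conjI sum.neutral ballI) blast+
  qed
  then show "mat_bracket A B \<in> mat_supported corner"
    by (simp add: mat_supported_def mat_bracket_def)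
qed (use subspace_mat_supported mat_supported_corner_subset in auto)

section \<open>The index of the strictly upper triangular matrices\<close>

text \<open>
  Ranks start at 0, so a position on the antidiagonal has rank sum \<open>n - 1\<close>.
\<close>

definition antidiagonal :: "('n::{finite,linorder} \<times> 'n) set" where
  "antidiagonal = {(i, j). i < j \<and> rank_of i + rank_of j = CARD('n) - 1}"

definition antidiagonal_form ::
    "'k::field^'n::{finite,linorder}^'n::{finite,linorder} \<Rightarrow> 'k" where
  "antidiagonal_form A = (\<Sum>(i, j)\<in>antidiagonal. A $ i $ j)"

lemma antidiagonal_form_dual: "antidiagonal_form \<in> nil_sl.dual_space"
  by (auto simp: nil_sl.dual_space_def antidiagonal_form_def mat_scale_nth sum.distrib
      sum_distrib_left split_def)

lemma card_antidiagonal_le: "card (antidiagonal :: ('n::{finite,linorder} \<times> 'n) set) \<le> CARD('n) div 2"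
proof -
  have "inj_on fst (antidiagonal :: ('n \<times> 'n) set)"
    by (auto simp: inj_on_def antidiagonal_def simp flip: rank_of_eq_iff)
  then have "card (antidiagonal :: ('n \<times> 'n) set) = card (fst ` (antidiagonal :: ('n \<times> 'n) set))"
    by (rule card_image[symmetric])
  also have "\<dots> \<le> card {i :: 'n. rank_of i < CARD('n) div 2}"
  proof (intro card_mono)
    have "rank_of i < CARD('n) div 2" if "i < j" "rank_of i + rank_of j = CARD('n) - 1" for i j :: 'n
      using that unfolding rank_of_less_iff[symmetric] by linarith
    then show "fst ` (antidiagonal :: ('n \<times> 'n) set) \<subseteq> {i :: 'n. rank_of i < CARD('n) div 2}"
      by (auto simp: antidiagonal_def)
  qed simp
  also have "\<dots> = CARD('n) div 2" by (rule card_rank_of_less) simp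
  finally show ?thesis .
qed

lemma bracket_mat_unit_nth:
  "mat_bracket A (mat_unit (a, b)) $ i $ j
    = (if j = b then A $ i $ a else 0) - (if i = a then A $ b $ j else 0)"
proof -
  have "(A ** mat_unit (a, b)) $ i $ j = (\<Sum>k\<in>UNIV. if k = a then (if j = b then A $ i $ a else 0) else 0)"
    unfolding mat_mult_nth by (intro sum.cong) (auto simp: mat_unit_nth)
  moreover have "(mat_unit (a, b) ** A) $ i $ j = (\<Sum>k\<in>UNIV. if k = b then (if i = a then A $ b $ j else 0) else 0)"
    unfolding mat_mult_nth by (intro sum.cong) (auto simp: mat_unit_nth)
  ultimately show ?thesis by (simp add: mat_bracket_def)
qed

text \<open>
  Write \<open>i'\<close> for the index opposite to \<open>i\<close>. An entry \<open>A\<^sub>c\<^sub>d\<close> off the antidiagonal is detected by a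
  single matrix unit: for \<open>d < c'\<close>, the bracket with \<open>E\<close> at \<open>(d, c')\<close> moves it to the antidiagonal
  position \<open>(c, c')\<close>, and for \<open>c' < d\<close> the bracket with \<open>E\<close> at \<open>(d', c)\<close> moves it to \<open>(d', d)\<close>. Every
  other contribution to the form would come from an entry of \<open>A\<close> on or below the diagonal.
\<close>

lemma stabilizer_antidiagonal_form:
  "nil_sl.stabilizer antidiagonal_form
    \<subseteq> (mat_supported antidiagonal :: ('k::field^'n::{finite,linorder}^'n::{finite,linorder}) set)"
proof
  fix A :: "(('k, 'n) vec, 'n) vec"
  assume "A \<in> nil_sl.stabilizer antidiagonal_form"
  then have A0: "\<And>i j. rank_of j \<le> rank_of i \<Longrightarrow> A $ i $ j = 0"
    and stab: "\<And>B. B \<in> strictly_upper \<Longrightarrow> antidiagonal_form (mat_bracket A B) = 0"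
    unfolding nil_sl.stabilizer_def
    by (auto simp: strictly_upper_def not_less[symmetric] rank_of_less_iff)
  have unit: "(\<Sum>(i, j)\<in>antidiagonal. (if j = b then A $ i $ a else 0)
      - (if i = a then A $ b $ j else 0)) = 0" if "rank_of a < rank_of b" for a b
    using stab[of "mat_unit (a, b)"] that
    by (auto simp: antidiagonal_form_def bracket_mat_unit_nth strictly_upper_def mat_unit_nth
        rank_of_less_iff)
  let ?n = "CARD('n) - 1"
  have rk: "rank_of i \<le> ?n" for i :: 'n using rank_of_less_CARD[of i] by simp
  have opp: "\<exists>j :: 'n. rank_of j = ?n - rank_of i" for i :: 'n
    by (rule ex_rank_of) (simp add: less_imp_diff_less)
  have "A $ c $ d = 0" if cd: "rank_of c < rank_of d" "rank_of c + rank_of d \<noteq> ?n" for c d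
  proof -
    consider "rank_of c + rank_of d < ?n" | "?n < rank_of c + rank_of d" using cd(2) by linarith
    then show ?thesis
    proof cases
      case 1
      obtain c' :: 'n where c': "rank_of c' = ?n - rank_of c" using opp by blast
      let ?f = "\<lambda>(i, j). (if j = c' then A $ i $ d else 0) - (if i = d then A $ c' $ j else 0)"
      have "(\<Sum>p\<in>antidiagonal. ?f p) = (\<Sum>p\<in>{(c, c')}. ?f p)"
      proof (rule sum.mono_neutral_right)
        show "{(c, c')} \<subseteq> antidiagonal"
          using 1 cd(1) c' rk[of c] by (auto simp: antidiagonal_def simp flip: rank_of_less_iff)
        show "\<forall>p\<in>antidiagonal - {(c, c')}. ?f p = 0"
        proof
          fix p assume p: "p \<in> antidiagonal - {(c, c')}"
          obtain i j where ij: "p = (i, j)" by (cases p)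
          from p ij have s: "rank_of i + rank_of j = ?n" by (auto simp: antidiagonal_def)
          have "j \<noteq> c'"
          proof
            assume "j = c'"
            moreover from this have "rank_of i = rank_of c" using s c' rk[of c] by simp
            ultimately show False using p ij by (simp add: rank_of_eq_iff)
          qed
          moreover have "A $ c' $ j = 0" if "i = d"
            by (rule A0) (use that s c' cd(1) in simp)
          ultimately show "?f p = 0" using ij by simp
        qed
      qed simp
      also have "\<dots> = A $ c $ d" using cd(1) by auto
      finally show ?thesis using unit[of d c'] 1 c' by simp
    next
      case 2
      obtain d' :: 'n where d': "rank_of d' = ?n - rank_of d" using opp by blast
      let ?f = "\<lambda>(i, j). (if j = c then A $ i $ d' else 0) - (if i = d' then A $ c $ j else 0)"
      have "(\<Sum>p\<in>antidiagonal. ?f p) = (\<Sum>p\<in>{(d', d)}. ?f p)"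
      proof (rule sum.mono_neutral_right)
        show "{(d', d)} \<subseteq> antidiagonal"
          using 2 cd(1) d' rk[of d] by (auto simp: antidiagonal_def simp flip: rank_of_less_iff)
        show "\<forall>p\<in>antidiagonal - {(d', d)}. ?f p = 0"
        proof
          fix p assume p: "p \<in> antidiagonal - {(d', d)}"
          obtain i j where ij: "p = (i, j)" by (cases p)
          from p ij have s: "rank_of i + rank_of j = ?n" by (auto simp: antidiagonal_def)
          have "i \<noteq> d'"
          proof
            assume "i = d'"
            moreover from this have "rank_of j = rank_of d" using s d' rk[of d] by simp
            ultimately show False using p ij by (simp add: rank_of_eq_iff)
          qed
          moreover have "A $ i $ d' = 0" if "j = c"
            by (rule A0) (use that s d' cd(1) in simp)
          ultimately show "?f p = 0" using ij by simp
        qed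
      qed simp
      also have "\<dots> = - A $ c $ d" using cd(1) by auto
      finally show ?thesis using unit[of d' c] 2 d' rk[of d] by simp
    qed
  qed
  then have "A $ i $ j = 0" if "(i, j) \<notin> antidiagonal" for i j
    using A0[of j i] that
    by (cases "rank_of i < rank_of j") (auto simp: antidiagonal_def simp flip: rank_of_less_iff)
  then show "A \<in> mat_supported antidiagonal" by (simp add: mat_supported_def)
qed

lemma card_less_pairs:
  "2 * card {(i, j :: 'n::{finite,linorder}). i < j} + CARD('n) = CARD('n)\<^sup>2"
proof -
  let ?lt = "{(i, j :: 'n). i < j}"
  have "(UNIV :: ('n \<times> 'n) set) = ?lt \<union> prod.swap ` ?lt \<union> range (\<lambda>i. (i, i))"
    by (auto simp: image_iff)
  also have "card \<dots> = card ?lt + card (prod.swap ` ?lt) + card (range (\<lambda>i :: 'n. (i, i)))"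
    by (subst card_Un_disjoint; (subst card_Un_disjoint)?) auto
  also have "card (prod.swap ` ?lt) = card ?lt" by (simp add: card_image)
  also have "card (range (\<lambda>i :: 'n. (i, i))) = CARD('n)" by (simp add: card_image inj_def)
  finally show ?thesis by (simp add: power2_eq_square)
qed

text \<open>
  With \<open>n div 2\<close> for the index, this says that the magic number is \<open>n\<^sup>2 div 4\<close>.
\<close>

lemma dim_strictly_upper_plus_half:
  "mat.dim (strictly_upper :: ('k::field^'n::{finite,linorder}^'n::{finite,linorder}) set)
    + CARD('n) div 2 = 2 * (CARD('n)\<^sup>2 div 4)"
proof -
  have "2 * (n\<^sup>2 div 4) * 2 + n = n\<^sup>2 + 2 * (n div 2)" for n :: nat
  proof (cases "even n")
    case True
    then obtain q where "n = 2 * q" by (elim evenE)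
    then show ?thesis by (simp add: power2_eq_square)
  next
    case False
    then obtain q where q: "n = 2 * q + 1" by (elim oddE)
    have "n\<^sup>2 = 1 + 4 * (q * (q + 1))" by (simp add: q power2_eq_square algebra_simps)
    moreover have "n\<^sup>2 div 4 = q * (q + 1)" using quarter_square[of n] q by simp
    moreover have "n div 2 = q" using q by simp
    ultimately show ?thesis using q by linarith
  qed
  from this[of "CARD('n)"] card_less_pairs[where 'n='n] show ?thesis
    by (simp add: strictly_upper_eq dim_mat_supported)
qed

text \<open>
  The antidiagonal form bounds the index from above; the isotropy of the corner bounds every
  stabilizer from below.
\<close>

lemma lie_index_strictly_upper:
  "fin_dim_lie_algebra.lie_index mat_scale mat_bracket
    (strictly_upper :: ('k::field^'n::{finite,linorder}^'n::{finite,linorder}) set)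
    = CARD('n) div 2"
proof (rule antisym)
  let ?N = "strictly_upper :: (('k, 'n) vec, 'n) vec set"
  let ?\<xi> = "antidiagonal_form :: (('k, 'n) vec, 'n) vec \<Rightarrow> 'k"
  let ?i = "fin_dim_lie_algebra.lie_index mat_scale mat_bracket ?N"
  have "?i \<le> mat.dim (nil_sl.stabilizer ?\<xi>)"
    unfolding nil_sl.lie_index_def
    by (rule cINF_lower) (simp_all add: antidiagonal_form_dual)
  also have "\<dots> \<le> mat.dim (mat_supported antidiagonal :: (('k, 'n) vec, 'n) vec set)"
    by (rule mat.dim_subset[OF stabilizer_antidiagonal_form])
  also have "\<dots> \<le> CARD('n) div 2"
    by (simp add: dim_mat_supported card_antidiagonal_le)
  finally show "?i \<le> CARD('n) div 2" .
  show "CARD('n) div 2 \<le> ?i"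
    unfolding nil_sl.lie_index_def
  proof (rule cINF_greatest)
    show "(nil_sl.dual_space :: ((('k, 'n) vec, 'n) vec \<Rightarrow> 'k) set) \<noteq> {}"
      using antidiagonal_form_dual by blast
    fix \<xi> :: "(('k, 'n) vec, 'n) vec \<Rightarrow> 'k"
    assume "\<xi> \<in> nil_sl.dual_space"
    from dim_abelian_subalgebra_le[OF nil_sl.fin_dim_lie_algebra_axioms
        abelian_subalgebra_corner[OF nil_sl.fin_dim_lie_algebra_axioms order_refl] this]
    show "CARD('n) div 2 \<le> mat.dim (nil_sl.stabilizer \<xi>)"
      using dim_strictly_upper_plus_half[where 'k='k and 'n='n]
      by (simp add: dim_mat_supported card_corner)
  qed
qed

lemma commutative_polarization_corner:
  "nil_sl.commutative_polarization (mat_supported corner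
    :: ('k::field^'n::{finite,linorder}^'n::{finite,linorder}) set)"
proof -
  have "(of_nat (mat.dim (strictly_upper :: (('k, 'n) vec, 'n) vec set)) + of_nat (CARD('n) div 2) :: rat)
      = 2 * of_nat (CARD('n)\<^sup>2 div 4)"
    using arg_cong[OF dim_strictly_upper_plus_half[where 'k='k and 'n='n], of "of_nat :: nat \<Rightarrow> rat"]
    by (simp only: of_nat_add of_nat_mult of_nat_numeral)
  then show ?thesis
    unfolding nil_sl.commutative_polarization_def nil_sl.magic_number_def lie_index_strictly_upper
    by (simp add: dim_mat_supported card_corner
        abelian_subalgebra_corner[OF nil_sl.fin_dim_lie_algebra_axioms])
qed

theorem theorem6p9:
  fixes N B \<LL> :: "('k::{alg_closed_field,field_char_0}^'n::{finite,linorder}^'n::{finite,linorder}) set"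
    and n :: nat
  assumes n: "n = CARD('n)"
    and N: "N = strictly_upper"
    and B: "B = upper_triangular0"
    and L: "\<LL> = special_linear"
  shows "\<exists>P.
      (fin_dim_lie_algebra.lie_ideal mat_scale mat_bracket N P \<and>
       fin_dim_lie_algebra.commutative_polarization mat_scale mat_bracket N P \<and>
       fin_dim_lie_algebra.alpha mat_scale mat_bracket N = n\<^sup>2 div 4 \<and>
       (\<forall>q. n = 2 * q \<longrightarrow> n\<^sup>2 div 4 = q\<^sup>2) \<and>
       (\<forall>q. n = 2 * q + 1 \<longrightarrow> n\<^sup>2 div 4 = q * (q + 1))) \<and>
      (fin_dim_lie_algebra.alpha mat_scale mat_bracket N = n\<^sup>2 div 4 \<and>
       fin_dim_lie_algebra.alpha mat_scale mat_bracket B = n\<^sup>2 div 4 \<and>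
       fin_dim_lie_algebra.alpha mat_scale mat_bracket \<LL> = n\<^sup>2 div 4) \<and>
      (fin_dim_lie_algebra.abelian_subalgebra mat_scale mat_bracket B P \<and>
       vector_space.dim mat_scale P = fin_dim_lie_algebra.alpha mat_scale mat_bracket B) \<and>
      (fin_dim_lie_algebra.abelian_subalgebra mat_scale mat_bracket \<LL> P \<and>
       vector_space.dim mat_scale P = fin_dim_lie_algebra.alpha mat_scale mat_bracket \<LL>)"
proof -
  let ?P = "mat_supported corner :: (('k, 'n) vec, 'n) vec set"
  have dimP: "mat.dim ?P = n\<^sup>2 div 4" by (simp add: dim_mat_supported card_corner n)
  have NB: "N \<subseteq> B" and BL: "B \<subseteq> \<LL>"
    unfolding N B L
    by (rule strictly_upper_subset_upper_triangular0 upper_triangular0_subset_special_linear)+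
  have lie: "fin_dim_lie_algebra mat_scale mat_bracket N"
    "fin_dim_lie_algebra mat_scale mat_bracket B"
    "fin_dim_lie_algebra mat_scale mat_bracket \<LL>"
    unfolding N B L
    by (rule nil_sl.fin_dim_lie_algebra_axioms borel_sl.fin_dim_lie_algebra_axioms
        sl.fin_dim_lie_algebra_axioms)+
  have abelian: "fin_dim_lie_algebra.abelian_subalgebra mat_scale mat_bracket M ?P"
    and alpha: "fin_dim_lie_algebra.alpha mat_scale mat_bracket M = n\<^sup>2 div 4"
    if "fin_dim_lie_algebra mat_scale mat_bracket M" "N \<subseteq> M" "M \<subseteq> \<LL>" for M
  proof -
    show "fin_dim_lie_algebra.abelian_subalgebra mat_scale mat_bracket M ?P"
      using abelian_subalgebra_corner[OF that(1)] that(2) N by simp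
    then show "fin_dim_lie_algebra.alpha mat_scale mat_bracket M = n\<^sup>2 div 4"
      using alpha_eqI[OF that(1)] that(3) dimP by (simp add: L n)
  qed
  have "n\<^sup>2 div 4 = q\<^sup>2" if "n = 2 * q" for q
    using that quarter_square[of n] by (simp add: power2_eq_square)
  moreover have "n\<^sup>2 div 4 = q * (q + 1)" if "n = 2 * q + 1" for q
    using that quarter_square[of n] by simp
  ultimately show ?thesis
    using lie_ideal_corner[where 'k='k and 'n='n]
      commutative_polarization_corner[where 'k='k and 'n='n]
      abelian[OF lie(2) NB BL] abelian[OF lie(3) order_trans[OF NB BL] order_refl]
      alpha[OF lie(1) order_refl order_trans[OF NB BL]] alpha[OF lie(2) NB BL]
      alpha[OF lie(3) order_trans[OF NB BL] order_refl] dimP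
    by (intro exI[of _ ?P]) (simp add: N)
qed

end
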